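(* Let $p\in\mathbb{C}[z]$ be a nonconstant polynomial of degree $d$ with only simple zeros and let $Z_p=\{(x,y,z)\in\mathbb{C}^3 : xy=p(z)\}$ be the corresponding smooth Danielewski surface with its volume form $\omega$. The Lie algebra of $\omega$-preserving polynomial vector fields on $Z_p$ is generated by the following complete volume-preserving vector fields: \[ y^nV,\quad n=0,\dots,\max(1,d-3);\qquad x^nW,\quad n=0,\dots,\max(1,d-3);\qquad z^mH,\quad m=0,\dots,\max(2,d-3). \]
   Context: On $Z_p$: $V=p'(z)\frac{\partial}{\partial x}+y\frac{\partial}{\partial z}$, $W=p'(z)\frac{\partial}{\partial y}+x\frac{\partial}{\partial z}$, $H=-x\frac{\partial}{\partial x}+y\frac{\partial}{\partial y}$. The holomorphic volume form on $Z_p$ is $\omega=\frac{dx\wedge dz}{x}=\frac{dz\wedge dy}{y}=\frac{dx\wedge dy}{p'(z)}$, where each expression is used where its denominator does not vanish and they agree on overlaps. A vector field $\Theta$ is volume-preserving ($\omega$-preserving) if the Lie derivative $\mathcal{L}_\Theta\omega$ vanishes. A polynomial vector field on $Z_p$ is an algebraic vector field, i.e. a $\mathbb{C}$-derivation of $\mathbb{C}[Z_p]$. A vector field is complete if its flow map exists for all complex times. "Generated" means generated as a complex Lie algebra under the Lie bracket of vector fields. *)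

theory Defs
  imports "HOL-Analysis.Analysis" "HOL-Computational_Algebra.Polynomial"
begin

section \<open>The surface and its coordinate ring\<close>

type_synonym point = "complex \<times> complex \<times> complex"

definition Danielewski :: "complex poly \<Rightarrow> point set" where
  "Danielewski p = {(x, y, z). x * y = poly p z}"

text \<open>Polynomial functions on the affine 3-space: the algebra generated by the coordinates.\<close>

inductive_set polyfun :: "(point \<Rightarrow> complex) set" where
  polyfun_const: "(\<lambda>_. c) \<in> polyfun"
| polyfun_x: "(\<lambda>(x, y, z). x) \<in> polyfun"
| polyfun_y: "(\<lambda>(x, y, z). y) \<in> polyfun"
| polyfun_z: "(\<lambda>(x, y, z). z) \<in> polyfun"
| polyfun_add: "F \<in> polyfun \<Longrightarrow> G \<in> polyfun \<Longrightarrow> (\<lambda>q. F q + G q) \<in> polyfun"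
| polyfun_mult: "F \<in> polyfun \<Longrightarrow> G \<in> polyfun \<Longrightarrow> (\<lambda>q. F q * G q) \<in> polyfun"

text \<open>A function on the surface is represented by its extension by 0 to the whole space, so that
  equality of representatives is equality on the surface.\<close>

definition on_surface :: "complex poly \<Rightarrow> (point \<Rightarrow> complex) \<Rightarrow> point \<Rightarrow> complex" where
  "on_surface p F = (\<lambda>q. if q \<in> Danielewski p then F q else 0)"

definition coord_ring :: "complex poly \<Rightarrow> (point \<Rightarrow> complex) set" where
  "coord_ring p = on_surface p ` polyfun"

section \<open>Algebraic vector fields\<close>

text \<open>An operator on functions. Algebraic vector fields are the complex derivations of the
  coordinate ring, extended by 0 to functions outside the coordinate ring; again this only serves
  to make equality of representatives meaningful.\<close>

type_synonym vfield = "(point \<Rightarrow> complex) \<Rightarrow> point \<Rightarrow> complex"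

definition vf_zero :: vfield where
  "vf_zero = (\<lambda>f q. 0)"

definition vf_add :: "vfield \<Rightarrow> vfield \<Rightarrow> vfield" where
  "vf_add A B = (\<lambda>f q. A f q + B f q)"

definition vf_mult :: "(point \<Rightarrow> complex) \<Rightarrow> vfield \<Rightarrow> vfield" where
  "vf_mult g A = (\<lambda>f q. g q * A f q)"

definition vf_scale :: "complex \<Rightarrow> vfield \<Rightarrow> vfield" where
  "vf_scale c A = vf_mult (\<lambda>_. c) A"

definition lie_bracket :: "vfield \<Rightarrow> vfield \<Rightarrow> vfield" where
  "lie_bracket A B = (\<lambda>f q. A (B f) q - B (A f) q)"

definition alg_vfields :: "complex poly \<Rightarrow> vfield set" where
  "alg_vfields p = {D.
     (\<forall>f \<in> coord_ring p. D f \<in> coord_ring p) \<and>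
     (\<forall>f. f \<notin> coord_ring p \<longrightarrow> D f = (\<lambda>_. 0)) \<and>
     (\<forall>f \<in> coord_ring p. \<forall>g \<in> coord_ring p. D (\<lambda>q. f q + g q) = (\<lambda>q. D f q + D g q)) \<and>
     (\<forall>c. \<forall>f \<in> coord_ring p. D (\<lambda>q. c * f q) = (\<lambda>q. c * D f q)) \<and>
     (\<forall>f \<in> coord_ring p. \<forall>g \<in> coord_ring p.
        D (\<lambda>q. f q * g q) = (\<lambda>q. D f q * g q + f q * D g q))}"

inductive_set lie_algebra_generated :: "vfield set \<Rightarrow> vfield set" for S :: "vfield set" where
  lie_gen_base: "A \<in> S \<Longrightarrow> A \<in> lie_algebra_generated S"
| lie_gen_zero: "vf_zero \<in> lie_algebra_generated S"
| lie_gen_add: "A \<in> lie_algebra_generated S \<Longrightarrow> B \<in> lie_algebra_generated S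
    \<Longrightarrow> vf_add A B \<in> lie_algebra_generated S"
| lie_gen_scale: "A \<in> lie_algebra_generated S \<Longrightarrow> vf_scale c A \<in> lie_algebra_generated S"
| lie_gen_bracket: "A \<in> lie_algebra_generated S \<Longrightarrow> B \<in> lie_algebra_generated S
    \<Longrightarrow> lie_bracket A B \<in> lie_algebra_generated S"

text \<open>The flow of \<open>D\<close> in complex time; the ODE \<open>d/dt \<phi>\<^sub>t(q) = D(\<phi>\<^sub>t(q))\<close> is tested against all
  regular functions.\<close>

definition complete_vfield :: "complex poly \<Rightarrow> vfield \<Rightarrow> bool" where
  "complete_vfield p D \<longleftrightarrow> (\<exists>\<phi> :: complex \<Rightarrow> point \<Rightarrow> point. \<forall>q \<in> Danielewski p.
     \<phi> 0 q = q \<and>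
     (\<forall>t. \<phi> t q \<in> Danielewski p) \<and>
     (\<forall>f \<in> coord_ring p. \<forall>t. ((\<lambda>s. f (\<phi> s q)) has_field_derivative D f (\<phi> t q)) (at t)))"

section \<open>The vector fields V, W and H\<close>

definition partial_x :: "(point \<Rightarrow> complex) \<Rightarrow> point \<Rightarrow> complex" where
  "partial_x F = (\<lambda>(x, y, z). deriv (\<lambda>s. F (s, y, z)) x)"

definition partial_y :: "(point \<Rightarrow> complex) \<Rightarrow> point \<Rightarrow> complex" where
  "partial_y F = (\<lambda>(x, y, z). deriv (\<lambda>s. F (x, s, z)) y)"

definition partial_z :: "(point \<Rightarrow> complex) \<Rightarrow> point \<Rightarrow> complex" where
  "partial_z F = (\<lambda>(x, y, z). deriv (\<lambda>s. F (x, y, s)) z)"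

text \<open>The vector field \<open>a \<partial>/\<partial>x + b \<partial>/\<partial>y + c \<partial>/\<partial>z\<close> of the ambient space, restricted to the
  surface: it is applied to some polynomial extension of the given regular function. If the field
  is tangent to the surface, the choice of the extension is immaterial; for \<open>V\<close>, \<open>W\<close> and \<open>H\<close> this
  is proved in \<open>field_V_on_surface\<close>, \<open>field_W_on_surface\<close> and \<open>field_H_on_surface\<close>.\<close>

definition restricted_field ::
  "complex poly \<Rightarrow> (point \<Rightarrow> complex) \<Rightarrow> (point \<Rightarrow> complex) \<Rightarrow> (point \<Rightarrow> complex) \<Rightarrow> vfield" where
  "restricted_field p a b c = (\<lambda>f.
     if f \<in> coord_ring p then
       let F = (SOME F. F \<in> polyfun \<and> on_surface p F = f)
       in on_surface p (\<lambda>q. a q * partial_x F q + b q * partial_y F q + c q * partial_z F q)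
     else (\<lambda>_. 0))"

definition field_V :: "complex poly \<Rightarrow> vfield" where
  "field_V p = restricted_field p (\<lambda>(x, y, z). poly (pderiv p) z) (\<lambda>_. 0) (\<lambda>(x, y, z). y)"

definition field_W :: "complex poly \<Rightarrow> vfield" where
  "field_W p = restricted_field p (\<lambda>_. 0) (\<lambda>(x, y, z). poly (pderiv p) z) (\<lambda>(x, y, z). x)"

definition field_H :: "complex poly \<Rightarrow> vfield" where
  "field_H p = restricted_field p (\<lambda>(x, y, z). - x) (\<lambda>(x, y, z). y) (\<lambda>_. 0)"

section \<open>The volume form\<close>

definition coord_x :: "complex poly \<Rightarrow> point \<Rightarrow> complex" where
  "coord_x p = on_surface p (\<lambda>(x, y, z). x)"

definition coord_y :: "complex poly \<Rightarrow> point \<Rightarrow> complex" where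
  "coord_y p = on_surface p (\<lambda>(x, y, z). y)"

definition coord_z :: "complex poly \<Rightarrow> point \<Rightarrow> complex" where
  "coord_z p = on_surface p (\<lambda>(x, y, z). z)"

text \<open>\<open>(df \<and> dg)(A, B)\<close>\<close>

definition wedge_d :: "(point \<Rightarrow> complex) \<Rightarrow> (point \<Rightarrow> complex) \<Rightarrow> vfield \<Rightarrow> vfield \<Rightarrow> point \<Rightarrow> complex"
  where "wedge_d f g A B = (\<lambda>q. A f q * B g q - A g q * B f q)"

text \<open>The evaluation \<open>\<omega>(A, B)\<close> of the volume form
  \<open>\<omega> = dx \<and> dz / x = dz \<and> dy / y = dx \<and> dy / p'(z)\<close>. By \<open>vol_form_eq\<close> below, the order of the
  cases is immaterial; on a smooth surface at least one of the denominators is nonzero.\<close>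

definition vol_form :: "complex poly \<Rightarrow> vfield \<Rightarrow> vfield \<Rightarrow> point \<Rightarrow> complex" where
  "vol_form p A B = on_surface p (\<lambda>(x, y, z).
     if x \<noteq> 0 then wedge_d (coord_x p) (coord_z p) A B (x, y, z) / x
     else if y \<noteq> 0 then wedge_d (coord_z p) (coord_y p) A B (x, y, z) / y
     else wedge_d (coord_x p) (coord_y p) A B (x, y, z) / poly (pderiv p) z)"

text \<open>The Lie derivative of a 2-form, given by its values on pairs of vector fields:
  \<open>(L\<^sub>\<Theta> \<eta>)(A, B) = \<Theta>(\<eta>(A, B)) - \<eta>([\<Theta>, A], B) - \<eta>(A, [\<Theta>, B])\<close>.
  For \<open>\<eta> = \<omega>\<close> on a smooth surface, the function \<open>\<omega>(A, B)\<close> is regular (\<open>vol_form_regular\<close>), so that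
  \<open>\<Theta>\<close> really differentiates it.\<close>

definition lie_derivative ::
  "vfield \<Rightarrow> (vfield \<Rightarrow> vfield \<Rightarrow> point \<Rightarrow> complex) \<Rightarrow> vfield \<Rightarrow> vfield \<Rightarrow> point \<Rightarrow> complex" where
  "lie_derivative \<Theta> \<eta> A B =
     (\<lambda>q. \<Theta> (\<eta> A B) q - \<eta> (lie_bracket \<Theta> A) B q - \<eta> A (lie_bracket \<Theta> B) q)"

text \<open>Since the surface is affine, the algebraic vector fields span every tangent space, so it
  suffices to evaluate the Lie derivative on them.\<close>

definition volume_preserving :: "complex poly \<Rightarrow> vfield \<Rightarrow> bool" where
  "volume_preserving p \<Theta> \<longleftrightarrow>
     (\<forall>A \<in> alg_vfields p. \<forall>B \<in> alg_vfields p. lie_derivative \<Theta> (vol_form p) A B = (\<lambda>_. 0))"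

definition vp_alg_vfields :: "complex poly \<Rightarrow> vfield set" where
  "vp_alg_vfields p = {\<Theta> \<in> alg_vfields p. volume_preserving p \<Theta>}"

definition vp_generators :: "complex poly \<Rightarrow> vfield set" where
  "vp_generators p =
     {vf_mult (\<lambda>(x, y, z). y ^ n) (field_V p) | n. n \<le> max 1 (degree p - 3)} \<union>
     {vf_mult (\<lambda>(x, y, z). x ^ n) (field_W p) | n. n \<le> max 1 (degree p - 3)} \<union>
     {vf_mult (\<lambda>(x, y, z). z ^ m) (field_H p) | m. m \<le> max 2 (degree p - 3)}"

section \<open>Well-definedness\<close>

lemma polyfun_has_derivative_along:
  assumes "F \<in> polyfun"
    and "(X has_field_derivative a) (at t)" "(Y has_field_derivative b) (at t)"
        "(Z has_field_derivative c) (at t)"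
  shows "((\<lambda>s. F (X s, Y s, Z s)) has_field_derivative
           (a * partial_x F (X t, Y t, Z t) + b * partial_y F (X t, Y t, Z t)
             + c * partial_z F (X t, Y t, Z t))) (at t)"
proof -
  define d where "d F \<longleftrightarrow> (\<forall>X Y Z t a b c.
     (X has_field_derivative a) (at t) \<longrightarrow> (Y has_field_derivative b) (at t) \<longrightarrow>
     (Z has_field_derivative c) (at t) \<longrightarrow>
     ((\<lambda>s. F (X s, Y s, Z s)) has_field_derivative
           (a * partial_x F (X t, Y t, Z t) + b * partial_y F (X t, Y t, Z t)
             + c * partial_z F (X t, Y t, Z t))) (at t))"
    for F :: "point \<Rightarrow> complex"
  have dD: "((\<lambda>s. F (X s, Y s, Z s)) has_field_derivative
           (a * partial_x F (X t, Y t, Z t) + b * partial_y F (X t, Y t, Z t)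
             + c * partial_z F (X t, Y t, Z t))) (at t)"
    if "d F" "(X has_field_derivative a) (at t)" "(Y has_field_derivative b) (at t)"
        "(Z has_field_derivative c) (at t)" for F X Y Z t a b c
    using that unfolding d_def by simp
  have ax: "((\<lambda>s. F (s, y, z)) has_field_derivative partial_x F (x, y, z)) (at x)"
    if "d F" for F x y z
    using dD[OF that, of "\<lambda>s. s" 1 x "\<lambda>_. y" 0 "\<lambda>_. z" 0] by simp
  have ay: "((\<lambda>s. F (x, s, z)) has_field_derivative partial_y F (x, y, z)) (at y)"
    if "d F" for F x y z
    using dD[OF that, of "\<lambda>_. x" 0 y "\<lambda>s. s" 1 "\<lambda>_. z" 0] by simp
  have az: "((\<lambda>s. F (x, y, s)) has_field_derivative partial_z F (x, y, z)) (at z)"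
    if "d F" for F x y z
    using dD[OF that, of "\<lambda>_. x" 0 z "\<lambda>_. y" 0 "\<lambda>s. s" 1] by simp
  from assms(1) have "d F"
  proof induction
    case (polyfun_add F G)
    note dF = polyfun_add.IH(1) and dG = polyfun_add.IH(2)
    have px: "partial_x (\<lambda>q. F q + G q) (x, y, z) = partial_x F (x, y, z) + partial_x G (x, y, z)" for x y z
      using DERIV_imp_deriv[OF DERIV_add[OF ax[OF dF, where x = x and y = y and z = z] ax[OF dG, where x = x and y = y and z = z]]]
      by (simp add: partial_x_def[of "\<lambda>q. F q + G q"] algebra_simps)
    have py: "partial_y (\<lambda>q. F q + G q) (x, y, z) = partial_y F (x, y, z) + partial_y G (x, y, z)" for x y z
      using DERIV_imp_deriv[OF DERIV_add[OF ay[OF dF, where x = x and y = y and z = z] ay[OF dG, where x = x and y = y and z = z]]]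
      by (simp add: partial_y_def[of "\<lambda>q. F q + G q"] algebra_simps)
    have pz: "partial_z (\<lambda>q. F q + G q) (x, y, z) = partial_z F (x, y, z) + partial_z G (x, y, z)" for x y z
      using DERIV_imp_deriv[OF DERIV_add[OF az[OF dF, where x = x and y = y and z = z] az[OF dG, where x = x and y = y and z = z]]]
      by (simp add: partial_z_def[of "\<lambda>q. F q + G q"] algebra_simps)
    show ?case
      unfolding d_def px py pz
    proof (intro allI impI)
      fix X Y Z :: "complex \<Rightarrow> complex" and t a b c
      assume XYZ: "(X has_field_derivative a) (at t)" "(Y has_field_derivative b) (at t)"
        "(Z has_field_derivative c) (at t)"
      show "((\<lambda>s. F (X s, Y s, Z s) + G (X s, Y s, Z s)) has_field_derivative
          (a * (partial_x F (X t, Y t, Z t) + partial_x G (X t, Y t, Z t))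
          + b * (partial_y F (X t, Y t, Z t) + partial_y G (X t, Y t, Z t))
          + c * (partial_z F (X t, Y t, Z t) + partial_z G (X t, Y t, Z t)))) (at t)"
        using DERIV_add[OF dD[OF dF XYZ] dD[OF dG XYZ]] by (simp add: algebra_simps)
    qed
  next
    case (polyfun_mult F G)
    note dF = polyfun_mult.IH(1) and dG = polyfun_mult.IH(2)
    have px: "partial_x (\<lambda>q. F q * G q) (x, y, z) = partial_x F (x, y, z) * G (x, y, z) + F (x, y, z) * partial_x G (x, y, z)" for x y z
      using DERIV_imp_deriv[OF DERIV_mult[OF ax[OF dF, where x = x and y = y and z = z] ax[OF dG, where x = x and y = y and z = z]]]
      by (simp add: partial_x_def[of "\<lambda>q. F q * G q"] algebra_simps)
    have py: "partial_y (\<lambda>q. F q * G q) (x, y, z) = partial_y F (x, y, z) * G (x, y, z) + F (x, y, z) * partial_y G (x, y, z)" for x y z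
      using DERIV_imp_deriv[OF DERIV_mult[OF ay[OF dF, where x = x and y = y and z = z] ay[OF dG, where x = x and y = y and z = z]]]
      by (simp add: partial_y_def[of "\<lambda>q. F q * G q"] algebra_simps)
    have pz: "partial_z (\<lambda>q. F q * G q) (x, y, z) = partial_z F (x, y, z) * G (x, y, z) + F (x, y, z) * partial_z G (x, y, z)" for x y z
      using DERIV_imp_deriv[OF DERIV_mult[OF az[OF dF, where x = x and y = y and z = z] az[OF dG, where x = x and y = y and z = z]]]
      by (simp add: partial_z_def[of "\<lambda>q. F q * G q"] algebra_simps)
    show ?case
      unfolding d_def px py pz
    proof (intro allI impI)
      fix X Y Z :: "complex \<Rightarrow> complex" and t a b c
      assume XYZ: "(X has_field_derivative a) (at t)" "(Y has_field_derivative b) (at t)"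
        "(Z has_field_derivative c) (at t)"
      show "((\<lambda>s. F (X s, Y s, Z s) * G (X s, Y s, Z s)) has_field_derivative
          (a * (partial_x F (X t, Y t, Z t) * G (X t, Y t, Z t)
            + F (X t, Y t, Z t) * partial_x G (X t, Y t, Z t))
          + b * (partial_y F (X t, Y t, Z t) * G (X t, Y t, Z t)
            + F (X t, Y t, Z t) * partial_y G (X t, Y t, Z t))
          + c * (partial_z F (X t, Y t, Z t) * G (X t, Y t, Z t)
            + F (X t, Y t, Z t) * partial_z G (X t, Y t, Z t)))) (at t)"
        using DERIV_mult[OF dD[OF dF XYZ] dD[OF dG XYZ]] by (simp add: algebra_simps)
    qed
  qed (simp_all add: d_def partial_x_def partial_y_def partial_z_def)
  then show ?thesis
    by (rule dD[OF _ assms(2-4)])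
qed

text \<open>If every vector of the field is the velocity of a curve in the surface, the field may be
  computed with any polynomial extension.\<close>

lemma restricted_field_on_surface:
  assumes F: "F \<in> polyfun"
    and curve: "\<And>x y z. (x, y, z) \<in> Danielewski p \<Longrightarrow> \<exists>X Y Z.
      (\<forall>s::complex. (X s, Y s, Z s) \<in> Danielewski p) \<and> (X 0, Y 0, Z 0) = (x, y, z) \<and>
      (X has_field_derivative a (x, y, z)) (at 0) \<and>
      (Y has_field_derivative b (x, y, z)) (at 0) \<and>
      (Z has_field_derivative c (x, y, z)) (at 0)"
  shows "restricted_field p a b c (on_surface p F) =
    on_surface p (\<lambda>q. a q * partial_x F q + b q * partial_y F q + c q * partial_z F q)"
proof -
  define G where "G = (SOME G. G \<in> polyfun \<and> on_surface p G = on_surface p F)"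
  have "G \<in> polyfun \<and> on_surface p G = on_surface p F"
    unfolding G_def by (rule someI[of _ F]) (use F in simp)
  then have G: "G \<in> polyfun" and GF: "on_surface p G = on_surface p F" by auto
  have eq: "G q = F q" if "q \<in> Danielewski p" for q
    using fun_cong[OF GF, of q] that by (simp add: on_surface_def)
  have "a q * partial_x G q + b q * partial_y G q + c q * partial_z G q =
        a q * partial_x F q + b q * partial_y F q + c q * partial_z F q"
    if q: "q \<in> Danielewski p" for q
  proof -
    obtain x y z where xyz: "q = (x, y, z)" by (cases q)
    from curve[OF q[unfolded xyz]] obtain X Y Z where c:
      "\<And>s. (X s, Y s, Z s) \<in> Danielewski p" "(X 0, Y 0, Z 0) = (x, y, z)"
      "(X has_field_derivative a (x, y, z)) (at 0)" "(Y has_field_derivative b (x, y, z)) (at 0)"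
      "(Z has_field_derivative c (x, y, z)) (at 0)" by blast
    have GFc: "(\<lambda>s. G (X s, Y s, Z s)) = (\<lambda>s. F (X s, Y s, Z s))"
      using c(1) by (intro ext eq)
    show ?thesis
      using DERIV_unique[OF polyfun_has_derivative_along[OF G c(3-5), unfolded GFc]
          polyfun_has_derivative_along[OF F c(3-5)]]
      unfolding c(2) xyz .
  qed
  moreover have "on_surface p F \<in> coord_ring p"
    using F by (simp add: coord_ring_def)
  ultimately show ?thesis
    unfolding restricted_field_def G_def[symmetric] Let_def
    by (simp add: on_surface_def fun_eq_iff)
qed

lemma field_V_on_surface:
  assumes "F \<in> polyfun"
  shows "field_V p (on_surface p F) =
    on_surface p (\<lambda>(x, y, z). poly (pderiv p) z * partial_x F (x, y, z) + y * partial_z F (x, y, z))"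
proof -
  have "\<exists>X Y Z. (\<forall>s::complex. (X s, Y s, Z s) \<in> Danielewski p) \<and> (X 0, Y 0, Z 0) = (x, y, z) \<and>
      (X has_field_derivative poly (pderiv p) z) (at 0) \<and>
      (Y has_field_derivative 0) (at 0) \<and> (Z has_field_derivative y) (at 0)"
    if "(x, y, z) \<in> Danielewski p" for x y z
  proof (cases "y = 0")
    case True
    show ?thesis
      by (rule exI[of _ "\<lambda>s. x + s * poly (pderiv p) z"], rule exI[of _ "\<lambda>_. y"], rule exI[of _ "\<lambda>_. z"])
        (insert that True, auto simp: Danielewski_def intro!: derivative_eq_intros)
  next
    case False
    show ?thesis
      by (rule exI[of _ "\<lambda>s. poly p (z + s * y) / y"], rule exI[of _ "\<lambda>_. y"], rule exI[of _ "\<lambda>s. z + s * y"])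
        (insert that False, auto simp: Danielewski_def field_simps intro!: derivative_eq_intros)
  qed
  then show ?thesis
    unfolding field_V_def
    by (subst restricted_field_on_surface[OF assms]) (auto simp: on_surface_def)
qed

lemma field_W_on_surface:
  assumes "F \<in> polyfun"
  shows "field_W p (on_surface p F) =
    on_surface p (\<lambda>(x, y, z). poly (pderiv p) z * partial_y F (x, y, z) + x * partial_z F (x, y, z))"
proof -
  have "\<exists>X Y Z. (\<forall>s::complex. (X s, Y s, Z s) \<in> Danielewski p) \<and> (X 0, Y 0, Z 0) = (x, y, z) \<and>
      (X has_field_derivative 0) (at 0) \<and>
      (Y has_field_derivative poly (pderiv p) z) (at 0) \<and> (Z has_field_derivative x) (at 0)"
    if "(x, y, z) \<in> Danielewski p" for x y z
  proof (cases "x = 0")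
    case True
    show ?thesis
      by (rule exI[of _ "\<lambda>_. x"], rule exI[of _ "\<lambda>s. y + s * poly (pderiv p) z"], rule exI[of _ "\<lambda>_. z"])
        (insert that True, auto simp: Danielewski_def intro!: derivative_eq_intros)
  next
    case False
    show ?thesis
      by (rule exI[of _ "\<lambda>_. x"], rule exI[of _ "\<lambda>s. poly p (z + s * x) / x"], rule exI[of _ "\<lambda>s. z + s * x"])
        (insert that False, auto simp: Danielewski_def field_simps intro!: derivative_eq_intros)
  qed
  then show ?thesis
    unfolding field_W_def
    by (subst restricted_field_on_surface[OF assms]) (auto simp: on_surface_def)
qed

lemma field_H_on_surface:
  assumes "F \<in> polyfun"
  shows "field_H p (on_surface p F) =
    on_surface p (\<lambda>(x, y, z). - x * partial_x F (x, y, z) + y * partial_y F (x, y, z))"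
proof -
  have "\<exists>X Y Z. (\<forall>s::complex. (X s, Y s, Z s) \<in> Danielewski p) \<and> (X 0, Y 0, Z 0) = (x, y, z) \<and>
      (X has_field_derivative - x) (at 0) \<and>
      (Y has_field_derivative y) (at 0) \<and> (Z has_field_derivative 0) (at 0)"
    if "(x, y, z) \<in> Danielewski p" for x y z
    by (rule exI[of _ "\<lambda>s. x * exp (- s)"], rule exI[of _ "\<lambda>s. y * exp s"], rule exI[of _ "\<lambda>_. z"])
      (insert that, auto simp: Danielewski_def exp_minus field_simps intro!: derivative_eq_intros)
  then show ?thesis
    unfolding field_H_def
    by (subst restricted_field_on_surface[OF assms]) (auto simp: on_surface_def)
qed

lemma alg_vfield_poly_z:
  assumes D: "D \<in> alg_vfields p" and q: "(x, y, z) \<in> Danielewski p"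
  shows "on_surface p (\<lambda>(x, y, z). poly r z) \<in> coord_ring p \<and>
    D (on_surface p (\<lambda>(x, y, z). poly r z)) (x, y, z) = poly (pderiv r) z * D (coord_z p) (x, y, z)"
proof (induction r)
  case 0
  let ?o = "on_surface p (\<lambda>(x, y, z). poly 0 z)"
  have o: "?o = (\<lambda>_. 0)" by (auto simp: on_surface_def)
  have "on_surface p (\<lambda>_. 0) \<in> coord_ring p"
    by (auto simp: coord_ring_def polyfun_const)
  then have oc: "(\<lambda>_. 0) \<in> coord_ring p" by (simp add: on_surface_def)
  have "D (\<lambda>q. k * f q) = (\<lambda>q. k * D f q)" if "f \<in> coord_ring p" for f k
    using D that unfolding alg_vfields_def by blast
  from this[OF oc, of 0] have "D (\<lambda>_. 0) = (\<lambda>_. 0)" by simp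
  then show ?case unfolding o using oc by simp
next
  case (pCons c r)
  define R where "R = on_surface p (\<lambda>(x, y, z). poly r z)"
  define E where "E = on_surface p (\<lambda>_. 1)"
  have RC: "R \<in> coord_ring p" and DR: "D R (x, y, z) = poly (pderiv r) z * D (coord_z p) (x, y, z)"
    using pCons.IH by (auto simp: R_def)
  have EC: "E \<in> coord_ring p" and ZC: "coord_z p \<in> coord_ring p"
    by (auto simp: E_def coord_z_def coord_ring_def polyfun.intros)
  have clA: "(\<lambda>q. f q + g q) \<in> coord_ring p" if "f \<in> coord_ring p" "g \<in> coord_ring p" for f g
  proof -
    from that obtain F G where FG: "F \<in> polyfun" "f = on_surface p F" "G \<in> polyfun" "g = on_surface p G"
      by (auto simp: coord_ring_def)
    then have "(\<lambda>q. f q + g q) = on_surface p (\<lambda>q. F q + G q)" by (auto simp: on_surface_def)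
    with FG show ?thesis by (auto simp: coord_ring_def polyfun_add)
  qed
  have clM: "(\<lambda>q. f q * g q) \<in> coord_ring p" if "f \<in> coord_ring p" "g \<in> coord_ring p" for f g
  proof -
    from that obtain F G where FG: "F \<in> polyfun" "f = on_surface p F" "G \<in> polyfun" "g = on_surface p G"
      by (auto simp: coord_ring_def)
    then have "(\<lambda>q. f q * g q) = on_surface p (\<lambda>q. F q * G q)" by (auto simp: on_surface_def)
    with FG show ?thesis by (auto simp: coord_ring_def polyfun_mult)
  qed
  have clS: "(\<lambda>q. k * f q) \<in> coord_ring p" if "f \<in> coord_ring p" for k f
  proof -
    from that obtain F where FG: "F \<in> polyfun" "f = on_surface p F"
      by (auto simp: coord_ring_def)
    then have "(\<lambda>q. k * f q) = on_surface p (\<lambda>q. k * F q)" by (auto simp: on_surface_def)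
    with FG show ?thesis by (auto simp: coord_ring_def polyfun_mult polyfun_const)
  qed
  have L: "D (\<lambda>q. f q * g q) = (\<lambda>q. D f q * g q + f q * D g q)"
    if "f \<in> coord_ring p" "g \<in> coord_ring p" for f g
    using D that unfolding alg_vfields_def by blast
  have A: "D (\<lambda>q. f q + g q) = (\<lambda>q. D f q + D g q)"
    if "f \<in> coord_ring p" "g \<in> coord_ring p" for f g
    using D that unfolding alg_vfields_def by blast
  have S: "D (\<lambda>q. k * f q) = (\<lambda>q. k * D f q)" if "f \<in> coord_ring p" for f k
    using D that unfolding alg_vfields_def by blast
  have EE: "(\<lambda>q. E q * E q) = E" by (auto simp: E_def on_surface_def)
  have "D E (x, y, z) = 0"
    using fun_cong[OF L[OF EC EC], of "(x, y, z)"] q unfolding EE by (simp add: E_def on_surface_def)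
  moreover have eq: "on_surface p (\<lambda>(x, y, z). poly (pCons c r) z) = (\<lambda>q. c * E q + coord_z p q * R q)"
    by (auto simp: E_def R_def coord_z_def on_surface_def)
  ultimately show ?case
    unfolding eq using q DR
    by (simp add: A[OF clS[OF EC] clM[OF ZC RC]] S[OF EC] L[OF ZC RC] clA clS clM EC ZC RC)
      (simp add: coord_z_def R_def on_surface_def pderiv_pCons algebra_simps)
qed

lemma alg_vfield_tangent:
  assumes D: "D \<in> alg_vfields p" and q: "(x, y, z) \<in> Danielewski p"
  shows "x * D (coord_y p) (x, y, z) + y * D (coord_x p) (x, y, z) =
    poly (pderiv p) z * D (coord_z p) (x, y, z)"
proof -
  have XY: "coord_x p \<in> coord_ring p" "coord_y p \<in> coord_ring p"
    by (auto simp: coord_x_def coord_y_def coord_ring_def polyfun.intros)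
  have eq: "(\<lambda>q. coord_x p q * coord_y p q) = on_surface p (\<lambda>(x, y, z). poly p z)"
    by (auto simp: coord_x_def coord_y_def on_surface_def Danielewski_def)
  have "D (\<lambda>q. coord_x p q * coord_y p q) =
      (\<lambda>q. D (coord_x p) q * coord_y p q + coord_x p q * D (coord_y p) q)"
    using D XY unfolding alg_vfields_def by blast
  from fun_cong[OF this, of "(x, y, z)"] show ?thesis
    unfolding eq using alg_vfield_poly_z[OF D q, of p] q
    by (simp add: coord_x_def coord_y_def on_surface_def algebra_simps)
qed

lemma vol_form_eq:
  assumes "A \<in> alg_vfields p" "B \<in> alg_vfields p" and q: "(x, y, z) \<in> Danielewski p"
  shows "x \<noteq> 0 \<Longrightarrow> vol_form p A B (x, y, z) = wedge_d (coord_x p) (coord_z p) A B (x, y, z) / x"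
    and "y \<noteq> 0 \<Longrightarrow> vol_form p A B (x, y, z) = wedge_d (coord_z p) (coord_y p) A B (x, y, z) / y"
    and "poly (pderiv p) z \<noteq> 0 \<Longrightarrow>
      vol_form p A B (x, y, z) = wedge_d (coord_x p) (coord_y p) A B (x, y, z) / poly (pderiv p) z"
proof -
  let ?xz = "wedge_d (coord_x p) (coord_z p) A B (x, y, z)"
  let ?zy = "wedge_d (coord_z p) (coord_y p) A B (x, y, z)"
  let ?xy = "wedge_d (coord_x p) (coord_y p) A B (x, y, z)"
  let ?d = "poly (pderiv p) z"
  note a = alg_vfield_tangent[OF assms(1) q] and b = alg_vfield_tangent[OF assms(2) q]
  have 1: "x * ?xy = ?d * ?xz" unfolding wedge_d_def using a b by algebra
  have 2: "y * ?xy = ?d * ?zy" unfolding wedge_d_def using a b by algebra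
  have 3: "y * ?xz = x * ?zy" unfolding wedge_d_def using a b by algebra
  show "x \<noteq> 0 \<Longrightarrow> vol_form p A B (x, y, z) = ?xz / x"
    using q by (simp add: vol_form_def on_surface_def)
  show "y \<noteq> 0 \<Longrightarrow> vol_form p A B (x, y, z) = ?zy / y"
    using q 3 by (auto simp: vol_form_def on_surface_def field_simps)
  show "?d \<noteq> 0 \<Longrightarrow> vol_form p A B (x, y, z) = ?xy / ?d"
    using q 1 2 by (auto simp: vol_form_def on_surface_def field_simps)
qed

lemma vol_form_regular:
  assumes A: "A \<in> alg_vfields p" and B: "B \<in> alg_vfields p"
    and bezout: "a * p + b * pderiv p = 1"
  shows "vol_form p A B \<in> coord_ring p"
proof -
  have neg: "(\<lambda>q. - F q) \<in> polyfun" if "F \<in> polyfun" for F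
    using polyfun_mult[OF polyfun_const[of "-1"] that] by simp
  have pz: "(\<lambda>(x, y, z). poly r z) \<in> polyfun" for r
  proof (induction r)
    case 0
    then show ?case using polyfun_const[of 0] by (simp add: case_prod_unfold)
  next
    case (pCons c r)
    from polyfun_add[OF polyfun_const[of c] polyfun_mult[OF polyfun_z pCons.IH]]
    show ?case by (simp add: case_prod_unfold)
  qed
  have ex: "\<exists>F \<in> polyfun. D f = on_surface p F"
    if "D \<in> alg_vfields p" "f \<in> {coord_x p, coord_y p, coord_z p}" for D f
  proof -
    have "f \<in> coord_ring p"
      using that(2) by (auto simp: coord_x_def coord_y_def coord_z_def coord_ring_def polyfun.intros)
    then have "D f \<in> coord_ring p" using that(1) unfolding alg_vfields_def by blast
    then show ?thesis by (auto simp: coord_ring_def)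
  qed
  obtain Ax where Ax: "Ax \<in> polyfun" "A (coord_x p) = on_surface p Ax" using ex[OF A] by blast
  obtain Ay where Ay: "Ay \<in> polyfun" "A (coord_y p) = on_surface p Ay" using ex[OF A] by blast
  obtain Az where Az: "Az \<in> polyfun" "A (coord_z p) = on_surface p Az" using ex[OF A] by blast
  obtain Bx where Bx: "Bx \<in> polyfun" "B (coord_x p) = on_surface p Bx" using ex[OF B] by blast
  obtain By where By: "By \<in> polyfun" "B (coord_y p) = on_surface p By" using ex[OF B] by blast
  obtain Bz where Bz: "Bz \<in> polyfun" "B (coord_z p) = on_surface p Bz" using ex[OF B] by blast
  define F where "F = (\<lambda>q. (case q of (x, y, z) \<Rightarrow> poly a z) * ((case q of (x, y, z) \<Rightarrow> y) *
      (Ax q * Bz q + - (Az q * Bx q))) + (case q of (x, y, z) \<Rightarrow> poly b z) *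
      (Ax q * By q + - (Ay q * Bx q)))"
  have F: "F \<in> polyfun"
    unfolding F_def by (intro polyfun_add polyfun_mult neg pz polyfun_y Ax Ay Az Bx By Bz)
  have "vol_form p A B (x, y, z) = F (x, y, z)" if q: "(x, y, z) \<in> Danielewski p" for x y z
  proof -
    let ?d = "poly (pderiv p) z"
    have bz: "poly a z * (x * y) + poly b z * ?d = 1"
      using arg_cong[OF bezout, of "\<lambda>r. poly r z"] q by (simp add: Danielewski_def)
    have w: "wedge_d (coord_x p) (coord_z p) A B (x, y, z) =
          Ax (x, y, z) * Bz (x, y, z) - Az (x, y, z) * Bx (x, y, z)"
      "wedge_d (coord_x p) (coord_y p) A B (x, y, z) =
          Ax (x, y, z) * By (x, y, z) - Ay (x, y, z) * Bx (x, y, z)"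
      using q by (simp_all add: wedge_d_def Ax Ay Az Bx By Bz on_surface_def)
    have xz: "wedge_d (coord_x p) (coord_z p) A B (x, y, z) = x * vol_form p A B (x, y, z)"
    proof (cases "x = 0")
      case True
      have "y * wedge_d (coord_x p) (coord_z p) A B (x, y, z) = 0"
        "?d * wedge_d (coord_x p) (coord_z p) A B (x, y, z) = 0"
        unfolding wedge_d_def
        using alg_vfield_tangent[OF A q] alg_vfield_tangent[OF B q] True by algebra+
      with bz True show ?thesis by auto
    qed (simp add: vol_form_eq(1)[OF A B q])
    have xy: "wedge_d (coord_x p) (coord_y p) A B (x, y, z) = ?d * vol_form p A B (x, y, z)"
    proof (cases "?d = 0")
      case True
      have "x * wedge_d (coord_x p) (coord_y p) A B (x, y, z) = 0"
        unfolding wedge_d_def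
        using alg_vfield_tangent[OF A q] alg_vfield_tangent[OF B q] True by algebra
      with bz True show ?thesis by auto
    qed (simp add: vol_form_eq(3)[OF A B q])
    have "F (x, y, z) = (poly a z * (x * y) + poly b z * ?d) * vol_form p A B (x, y, z)"
      using xz xy unfolding w by (simp add: F_def algebra_simps)
    with bz show ?thesis by simp
  qed
  then have "vol_form p A B = on_surface p F"
    by (auto simp: fun_eq_iff on_surface_def vol_form_def)
  with F show ?thesis by (auto simp: coord_ring_def)
qed

end

theory Submission
  imports Defs "HOL-Computational_Algebra.Fundamental_Theorem_Algebra"
    "HOL-Computational_Algebra.Field_as_Ring"
    "HOL-Computational_Algebra.Polynomial_Factorial"
begin

text \<open>
  The volume form identifies functions with Hamiltonian vector fields: up to sign, \<open>V\<close>, \<open>W\<close> and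
  \<open>H\<close> are those of \<open>y\<close>, \<open>x\<close> and \<open>z\<close>, and the generators are those of the powers of the coordinates.
  A derivation is determined by its values on \<open>x\<close> and \<open>z\<close>, and \<open>\<Theta>\<close> preserves \<open>\<omega>\<close> iff
  \<open>\<Theta>(x) = W(\<Theta>(z)) - H(\<Theta>(x))\<close>, which says that \<open>\<Theta>\<close> has divergence \<open>0\<close> in the coordinates \<open>x, z\<close>.

  With the Poisson bracket \<open>{x, z} = x, {z, y} = y, {x, y} = p'(z)\<close>, the functions \<open>z, z\<^sup>2\<close> and \<open>y\<close>
  generate all \<open>y g(z)\<close>, likewise \<open>x g(z)\<close>; then \<open>{x g, y} = (p g)'\<close> supplies all large powers
  of \<open>z\<close>, and \<open>{y z, y\<^sup>n} = n y\<^sup>n\<^sup>+\<^sup>1\<close> all powers of \<open>y\<close>. Conversely, subtracting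
  Hamiltonian fields from a volume-preserving \<open>\<Theta>\<close> makes \<open>\<Theta>(z)\<close> a polynomial in \<open>z\<close>; it then
  vanishes, and \<open>\<Theta> = g(z) H\<close>.
\<close>

section \<open>The coordinate ring\<close>

lemma polyfun_power: "F \<in> polyfun \<Longrightarrow> (\<lambda>q. F q ^ n) \<in> polyfun"
proof (induction n)
  case 0
  show ?case using polyfun_const[of 1] by simp
next
  case (Suc n)
  then show ?case using polyfun_mult[of F "\<lambda>q. F q ^ n"] by simp
qed

lemma polyfun_poly_z: "(\<lambda>(x, y, z). poly g z) \<in> polyfun"
proof (induction g)
  case 0
  show ?case using polyfun_const[of 0] by (simp add: case_prod_unfold)
next
  case (pCons c g)
  from polyfun_add[OF polyfun_const[of c] polyfun_mult[OF polyfun_z pCons.IH]]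
  show ?case by (simp add: case_prod_unfold)
qed

lemma polyfun_monomial: "(\<lambda>(x, y, z). x ^ i * y ^ j * poly g z) \<in> polyfun"
  using polyfun_mult[OF polyfun_mult[OF polyfun_power[OF polyfun_x, of i] polyfun_power[OF polyfun_y, of j]]
      polyfun_poly_z[of g]]
  by (simp add: case_prod_unfold)

section \<open>Partial derivatives of polynomial functions\<close>

lemma polyfun_DERIV_partial:
  assumes "F \<in> polyfun"
  shows "((\<lambda>s. F (s, y, z)) has_field_derivative partial_x F (x, y, z)) (at x)"
    and "((\<lambda>s. F (x, s, z)) has_field_derivative partial_y F (x, y, z)) (at y)"
    and "((\<lambda>s. F (x, y, s)) has_field_derivative partial_z F (x, y, z)) (at z)"
  using polyfun_has_derivative_along[OF assms, of "\<lambda>s. s" 1 x "\<lambda>_. y" 0 "\<lambda>_. z" 0]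
    polyfun_has_derivative_along[OF assms, of "\<lambda>_. x" 0 y "\<lambda>s. s" 1 "\<lambda>_. z" 0]
    polyfun_has_derivative_along[OF assms, of "\<lambda>_. x" 0 z "\<lambda>_. y" 0 "\<lambda>s. s" 1]
  by simp_all

lemma polyfun_partials:
  assumes "F \<in> polyfun"
  shows "partial_x F \<in> polyfun \<and> partial_y F \<in> polyfun \<and> partial_z F \<in> polyfun"
  using assms
proof induction
  case (polyfun_const c)
  show ?case
    using polyfun.polyfun_const[of 0] by (simp add: partial_x_def partial_y_def partial_z_def case_prod_unfold)
next
  case polyfun_x
  show ?case
    using polyfun.polyfun_const[of 0] polyfun.polyfun_const[of 1]
    by (simp add: partial_x_def partial_y_def partial_z_def case_prod_unfold)
next
  case polyfun_y
  show ?case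
    using polyfun.polyfun_const[of 0] polyfun.polyfun_const[of 1]
    by (simp add: partial_x_def partial_y_def partial_z_def case_prod_unfold)
next
  case polyfun_z
  show ?case
    using polyfun.polyfun_const[of 0] polyfun.polyfun_const[of 1]
    by (simp add: partial_x_def partial_y_def partial_z_def case_prod_unfold)
next
  case (polyfun_add F G)
  have "partial_x (\<lambda>q. F q + G q) = (\<lambda>q. partial_x F q + partial_x G q)"
    by (auto simp: partial_x_def[of "\<lambda>q. F q + G q"] fun_eq_iff
        intro!: DERIV_imp_deriv DERIV_add polyfun_DERIV_partial polyfun_add.hyps)
  moreover have "partial_y (\<lambda>q. F q + G q) = (\<lambda>q. partial_y F q + partial_y G q)"
    by (auto simp: partial_y_def[of "\<lambda>q. F q + G q"] fun_eq_iff
        intro!: DERIV_imp_deriv DERIV_add polyfun_DERIV_partial polyfun_add.hyps)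
  moreover have "partial_z (\<lambda>q. F q + G q) = (\<lambda>q. partial_z F q + partial_z G q)"
    by (auto simp: partial_z_def[of "\<lambda>q. F q + G q"] fun_eq_iff
        intro!: DERIV_imp_deriv DERIV_add polyfun_DERIV_partial polyfun_add.hyps)
  ultimately show ?case using polyfun_add by (simp add: polyfun.polyfun_add)
next
  case (polyfun_mult F G)
  have "partial_x (\<lambda>q. F q * G q) = (\<lambda>q. partial_x F q * G q + partial_x G q * F q)"
    by (auto simp: partial_x_def[of "\<lambda>q. F q * G q"] fun_eq_iff
        intro!: DERIV_imp_deriv DERIV_mult polyfun_DERIV_partial polyfun_mult.hyps)
  moreover have "partial_y (\<lambda>q. F q * G q) = (\<lambda>q. partial_y F q * G q + partial_y G q * F q)"
    by (auto simp: partial_y_def[of "\<lambda>q. F q * G q"] fun_eq_iff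
        intro!: DERIV_imp_deriv DERIV_mult polyfun_DERIV_partial polyfun_mult.hyps)
  moreover have "partial_z (\<lambda>q. F q * G q) = (\<lambda>q. partial_z F q * G q + partial_z G q * F q)"
    by (auto simp: partial_z_def[of "\<lambda>q. F q * G q"] fun_eq_iff
        intro!: DERIV_imp_deriv DERIV_mult polyfun_DERIV_partial polyfun_mult.hyps)
  ultimately show ?case using polyfun_mult by (simp add: polyfun.polyfun_add polyfun.polyfun_mult)
qed

lemma coord_ring_cases:
  assumes "f \<in> coord_ring p"
  obtains F where "F \<in> polyfun" "f = on_surface p F"
  using assms by (auto simp: coord_ring_def)

lemma on_surface_coord_ring: "F \<in> polyfun \<Longrightarrow> on_surface p F \<in> coord_ring p"
  by (simp add: coord_ring_def)

lemma coord_ring_off: "f \<in> coord_ring p \<Longrightarrow> q \<notin> Danielewski p \<Longrightarrow> f q = 0"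
  by (auto simp: coord_ring_def on_surface_def)

lemma coord_ring_add:
  assumes "f \<in> coord_ring p" "g \<in> coord_ring p"
  shows "(\<lambda>q. f q + g q) \<in> coord_ring p"
proof -
  from assms obtain F G where FG: "F \<in> polyfun" "f = on_surface p F" "G \<in> polyfun" "g = on_surface p G"
    by (auto simp: coord_ring_def)
  then have "(\<lambda>q. f q + g q) = on_surface p (\<lambda>q. F q + G q)" by (auto simp: on_surface_def)
  with FG show ?thesis by (auto simp: coord_ring_def polyfun_add)
qed

lemma coord_ring_polyfun_mult:
  assumes "F \<in> polyfun" "g \<in> coord_ring p"
  shows "(\<lambda>q. F q * g q) \<in> coord_ring p"
proof -
  from assms obtain G where G: "G \<in> polyfun" "g = on_surface p G"
    by (auto simp: coord_ring_def)
  then have "(\<lambda>q. F q * g q) = on_surface p (\<lambda>q. F q * G q)" by (auto simp: on_surface_def)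
  with assms(1) G show ?thesis by (auto simp: coord_ring_def polyfun_mult)
qed

lemma coord_ring_scale: "g \<in> coord_ring p \<Longrightarrow> (\<lambda>q. c * g q) \<in> coord_ring p"
  by (rule coord_ring_polyfun_mult[OF polyfun_const])

lemma coord_ring_zero: "(\<lambda>_. 0) \<in> coord_ring p"
  using on_surface_coord_ring[OF polyfun_const[of 0]] by (simp add: on_surface_def)

lemma coord_ring_mult:
  assumes "f \<in> coord_ring p" "g \<in> coord_ring p"
  shows "(\<lambda>q. f q * g q) \<in> coord_ring p"
proof -
  from assms obtain F where F: "F \<in> polyfun" "f = on_surface p F"
    by (auto simp: coord_ring_def)
  have "(\<lambda>q. f q * g q) = (\<lambda>q. F q * g q)"
    using coord_ring_off[OF assms(2)] by (auto simp: F(2) on_surface_def fun_eq_iff)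
  with coord_ring_polyfun_mult[OF F(1) assms(2)] show ?thesis by simp
qed

lemma coord_ring_diff:
  assumes "f \<in> coord_ring p" "g \<in> coord_ring p"
  shows "(\<lambda>q. f q - g q) \<in> coord_ring p"
  using coord_ring_add[OF assms(1) coord_ring_scale[OF assms(2), of "-1"]] by simp

lemma coord_ring_coords [simp, intro]:
  "coord_x p \<in> coord_ring p" "coord_y p \<in> coord_ring p" "coord_z p \<in> coord_ring p"
  by (auto simp: coord_x_def coord_y_def coord_z_def polyfun.intros on_surface_coord_ring)

lemma coords_at [simp]:
  assumes "(x, y, z) \<in> Danielewski p"
  shows "coord_x p (x, y, z) = x" "coord_y p (x, y, z) = y" "coord_z p (x, y, z) = z"
  using assms by (simp_all add: coord_x_def coord_y_def coord_z_def on_surface_def)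

section \<open>Algebraic vector fields\<close>

lemma
  assumes "D \<in> alg_vfields p"
  shows alg_vfield_closed: "f \<in> coord_ring p \<Longrightarrow> D f \<in> coord_ring p"
    and alg_vfield_outside: "f \<notin> coord_ring p \<Longrightarrow> D f = (\<lambda>_. 0)"
    and alg_vfield_add: "f \<in> coord_ring p \<Longrightarrow> g \<in> coord_ring p \<Longrightarrow>
      D (\<lambda>q. f q + g q) = (\<lambda>q. D f q + D g q)"
    and alg_vfield_scale: "f \<in> coord_ring p \<Longrightarrow> D (\<lambda>q. c * f q) = (\<lambda>q. c * D f q)"
    and alg_vfield_mult: "f \<in> coord_ring p \<Longrightarrow> g \<in> coord_ring p \<Longrightarrow>
      D (\<lambda>q. f q * g q) = (\<lambda>q. D f q * g q + f q * D g q)"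
  using assms unfolding alg_vfields_def by blast+

lemma alg_vfieldI:
  assumes "\<And>f. f \<in> coord_ring p \<Longrightarrow> D f \<in> coord_ring p"
    and "\<And>f. f \<notin> coord_ring p \<Longrightarrow> D f = (\<lambda>_. 0)"
    and "\<And>f g. f \<in> coord_ring p \<Longrightarrow> g \<in> coord_ring p \<Longrightarrow> D (\<lambda>q. f q + g q) = (\<lambda>q. D f q + D g q)"
    and "\<And>c f. f \<in> coord_ring p \<Longrightarrow> D (\<lambda>q. c * f q) = (\<lambda>q. c * D f q)"
    and "\<And>f g. f \<in> coord_ring p \<Longrightarrow> g \<in> coord_ring p \<Longrightarrow>
      D (\<lambda>q. f q * g q) = (\<lambda>q. D f q * g q + f q * D g q)"
  shows "D \<in> alg_vfields p"
  using assms unfolding alg_vfields_def by blast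

lemma alg_vfield_diff:
  assumes "D \<in> alg_vfields p" "f \<in> coord_ring p" "g \<in> coord_ring p"
  shows "D (\<lambda>q. f q - g q) = (\<lambda>q. D f q - D g q)"
  using alg_vfield_add[OF assms(1,2) coord_ring_scale[OF assms(3), of "-1"]]
    alg_vfield_scale[OF assms(1,3), of "-1"] by simp

lemma alg_vfield_zero:
  assumes "D \<in> alg_vfields p"
  shows "D (\<lambda>_. 0) = (\<lambda>_. 0)"
  using alg_vfield_scale[OF assms coord_ring_zero, of 0] by simp

section \<open>Derivations are closed under the Lie algebra operations\<close>

lemma vf_zero_alg: "vf_zero \<in> alg_vfields p"
  by (rule alg_vfieldI) (auto simp: vf_zero_def coord_ring_zero)

lemma vf_add_alg:
  assumes "A \<in> alg_vfields p" "B \<in> alg_vfields p"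
  shows "vf_add A B \<in> alg_vfields p"
  by (rule alg_vfieldI)
    (simp_all add: vf_add_def coord_ring_add assms alg_vfield_closed[OF assms(1)]
      alg_vfield_closed[OF assms(2)] alg_vfield_outside[OF assms(1)] alg_vfield_outside[OF assms(2)]
      alg_vfield_add[OF assms(1)] alg_vfield_add[OF assms(2)] alg_vfield_scale[OF assms(1)]
      alg_vfield_scale[OF assms(2)] alg_vfield_mult[OF assms(1)] alg_vfield_mult[OF assms(2)]
      algebra_simps)

lemma vf_mult_alg:
  assumes "F \<in> polyfun" "A \<in> alg_vfields p"
  shows "vf_mult F A \<in> alg_vfields p"
  by (rule alg_vfieldI)
    (simp_all add: vf_mult_def coord_ring_polyfun_mult assms alg_vfield_closed[OF assms(2)]
      alg_vfield_outside[OF assms(2)] alg_vfield_add[OF assms(2)] alg_vfield_scale[OF assms(2)]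
      alg_vfield_mult[OF assms(2)] algebra_simps)

lemma vf_scale_alg: "A \<in> alg_vfields p \<Longrightarrow> vf_scale c A \<in> alg_vfields p"
  unfolding vf_scale_def by (rule vf_mult_alg[OF polyfun_const])

lemma lie_bracket_alg:
  assumes A: "A \<in> alg_vfields p" and B: "B \<in> alg_vfields p"
  shows "lie_bracket A B \<in> alg_vfields p"
proof (rule alg_vfieldI)
  note cl = alg_vfield_closed[OF A] alg_vfield_closed[OF B] coord_ring_add coord_ring_mult
    coord_ring_scale coord_ring_diff
  note ev = alg_vfield_add[OF A] alg_vfield_add[OF B] alg_vfield_scale[OF A] alg_vfield_scale[OF B]
    alg_vfield_mult[OF A] alg_vfield_mult[OF B]
  show "lie_bracket A B f \<in> coord_ring p" if "f \<in> coord_ring p" for f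
    using that by (simp add: lie_bracket_def cl)
  show "lie_bracket A B f = (\<lambda>_. 0)" if "f \<notin> coord_ring p" for f
    using that by (simp add: lie_bracket_def alg_vfield_outside[OF A] alg_vfield_outside[OF B]
        alg_vfield_zero[OF A] alg_vfield_zero[OF B])
  show "lie_bracket A B (\<lambda>q. f q + g q) = (\<lambda>q. lie_bracket A B f q + lie_bracket A B g q)"
    "lie_bracket A B (\<lambda>q. f q * g q) = (\<lambda>q. lie_bracket A B f q * g q + f q * lie_bracket A B g q)"
    if "f \<in> coord_ring p" "g \<in> coord_ring p" for f g
    using that by (simp_all add: lie_bracket_def cl ev algebra_simps)
  show "lie_bracket A B (\<lambda>q. c * f q) = (\<lambda>q. c * lie_bracket A B f q)"
    if "f \<in> coord_ring p" for f c
    using that by (simp_all add: lie_bracket_def cl ev algebra_simps)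
qed

text \<open>Both sides obey the same sum and product rules in \<open>F\<close>, so agreement on the
  three coordinates is enough. Only the point at time \<open>t\<close> has to lie on the surface;
  elsewhere the curve may leave it, because \<open>F\<close> is an ambient polynomial.\<close>

lemma alg_vfield_along:
  assumes D: "D \<in> alg_vfields p" and F: "F \<in> polyfun"
    and q: "(X t, Y t, Z t) \<in> Danielewski p"
    and d: "(X has_field_derivative D (coord_x p) (X t, Y t, Z t)) (at t)"
      "(Y has_field_derivative D (coord_y p) (X t, Y t, Z t)) (at t)"
      "(Z has_field_derivative D (coord_z p) (X t, Y t, Z t)) (at t)"
  shows "((\<lambda>s. F (X s, Y s, Z s)) has_field_derivative D (on_surface p F) (X t, Y t, Z t)) (at t)"
  using F
proof induction
  case (polyfun_const c)
  show ?case
    using alg_vfield_poly_z[OF D q, of "[:c:]"] by (simp add: case_prod_unfold)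
next
  case (polyfun_add F G)
  have "on_surface p (\<lambda>q. F q + G q) = (\<lambda>q. on_surface p F q + on_surface p G q)"
    by (auto simp: on_surface_def)
  then show ?case
    using DERIV_add[OF polyfun_add.IH] polyfun_add.hyps
    by (simp add: alg_vfield_add[OF D] on_surface_coord_ring)
next
  case (polyfun_mult F G)
  have "on_surface p (\<lambda>q. F q * G q) = (\<lambda>q. on_surface p F q * on_surface p G q)"
    by (auto simp: on_surface_def)
  then show ?case
    using DERIV_mult[OF polyfun_mult.IH] polyfun_mult.hyps q
    by (simp add: alg_vfield_mult[OF D] on_surface_coord_ring)
      (simp add: on_surface_def algebra_simps)
qed (use d in \<open>simp_all add: coord_x_def coord_y_def coord_z_def\<close>)

lemma alg_vfield_chain:
  assumes D: "D \<in> alg_vfields p" and F: "F \<in> polyfun" and q: "(x, y, z) \<in> Danielewski p"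
  shows "D (on_surface p F) (x, y, z) = D (coord_x p) (x, y, z) * partial_x F (x, y, z)
    + D (coord_y p) (x, y, z) * partial_y F (x, y, z) + D (coord_z p) (x, y, z) * partial_z F (x, y, z)"
proof -
  \<comment> \<open>The straight line through the point in the direction given by \<open>D\<close>.
    It meets the surface at time 0, which is all that \<open>alg_vfield_along\<close> asks.\<close>
  let ?X = "\<lambda>s. x + s * D (coord_x p) (x, y, z)" and ?Y = "\<lambda>s. y + s * D (coord_y p) (x, y, z)"
    and ?Z = "\<lambda>s. z + s * D (coord_z p) (x, y, z)"
  have d: "(?X has_field_derivative D (coord_x p) (x, y, z)) (at 0)"
    "(?Y has_field_derivative D (coord_y p) (x, y, z)) (at 0)"
    "(?Z has_field_derivative D (coord_z p) (x, y, z)) (at 0)"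
    by (auto intro!: derivative_eq_intros)
  show ?thesis
    using DERIV_unique[OF alg_vfield_along[OF D F, of ?X 0 ?Y ?Z]
        polyfun_has_derivative_along[OF F, of ?X _ 0 ?Y _ ?Z]] d q by simp
qed

text \<open>The formula for \<open>D\<close> is assumed for every polynomial extension of a
  function, so it already contains tangency to the surface. By \<open>dir\<close>, \<open>D\<close>
  is a derivative along an ambient line, and the derivation rules follow from those for derivatives
  and their uniqueness.\<close>

lemma alg_vfield_of_extension:
  assumes abc: "a \<in> polyfun" "b \<in> polyfun" "c \<in> polyfun"
    and D: "\<And>F. F \<in> polyfun \<Longrightarrow> D (on_surface p F) =
      on_surface p (\<lambda>q. a q * partial_x F q + b q * partial_y F q + c q * partial_z F q)"
    and out: "\<And>f. f \<notin> coord_ring p \<Longrightarrow> D f = (\<lambda>_. 0)"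
  shows "D \<in> alg_vfields p"
    and "D (coord_x p) = on_surface p a"
    and "D (coord_y p) = on_surface p b"
    and "D (coord_z p) = on_surface p c"
proof -
  have dir: "((\<lambda>s. F (x + s * a (x, y, z), y + s * b (x, y, z), z + s * c (x, y, z)))
      has_field_derivative D (on_surface p F) (x, y, z)) (at 0)"
    if F: "F \<in> polyfun" and q: "(x, y, z) \<in> Danielewski p" for F x y z
  proof -
    have line: "((\<lambda>s. u + s * v) has_field_derivative v) (at 0)" for u v :: complex
      by (auto intro!: derivative_eq_intros)
    have "D (on_surface p F) (x, y, z) = a (x, y, z) * partial_x F (x, y, z)
        + b (x, y, z) * partial_y F (x, y, z) + c (x, y, z) * partial_z F (x, y, z)"
      using q by (simp add: D[OF F]) (simp add: on_surface_def)
    then show ?thesis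
      using polyfun_has_derivative_along[OF F line[of x "a (x, y, z)"] line[of y "b (x, y, z)"]
          line[of z "c (x, y, z)"]] by simp
  qed
  have off: "D f q = 0" if "q \<notin> Danielewski p" for f q
    using that D out by (cases "f \<in> coord_ring p") (auto simp: on_surface_def elim!: coord_ring_cases)
  show "D \<in> alg_vfields p"
  proof (rule alg_vfieldI)
    show "D f \<in> coord_ring p" if "f \<in> coord_ring p" for f
    proof -
      from that obtain F where F: "F \<in> polyfun" "f = on_surface p F" by (rule coord_ring_cases)
      show ?thesis
        unfolding F(2) D[OF F(1)]
        by (intro on_surface_coord_ring polyfun_add polyfun_mult abc)
          (use polyfun_partials[OF F(1)] in simp_all)
    qed
    show "D f = (\<lambda>_. 0)" if "f \<notin> coord_ring p" for f
      by (rule out[OF that])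
    show "D (\<lambda>q. f q + g q) = (\<lambda>q. D f q + D g q)" if "f \<in> coord_ring p" "g \<in> coord_ring p" for f g
    proof -
      from that obtain F G where FG: "F \<in> polyfun" "f = on_surface p F" "G \<in> polyfun" "g = on_surface p G"
        by (auto simp: coord_ring_def)
      then have fg: "(\<lambda>q. f q + g q) = on_surface p (\<lambda>q. F q + G q)" by (auto simp: on_surface_def)
      have "D (\<lambda>q. f q + g q) (x, y, z) = D f (x, y, z) + D g (x, y, z)"
        if "(x, y, z) \<in> Danielewski p" for x y z
        using DERIV_unique[OF dir[OF polyfun_add[OF FG(1,3)] that] DERIV_add[OF dir[OF FG(1) that] dir[OF FG(3) that]]]
        unfolding fg unfolding FG .
      with off show ?thesis by (metis (no_types, lifting) ext add_0 prod_cases3)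
    qed
    show "D (\<lambda>q. f q * g q) = (\<lambda>q. D f q * g q + f q * D g q)"
      if "f \<in> coord_ring p" "g \<in> coord_ring p" for f g
    proof -
      from that obtain F G where FG: "F \<in> polyfun" "f = on_surface p F" "G \<in> polyfun" "g = on_surface p G"
        by (auto simp: coord_ring_def)
      then have fg: "(\<lambda>q. f q * g q) = on_surface p (\<lambda>q. F q * G q)" by (auto simp: on_surface_def)
      have "D (\<lambda>q. f q * g q) (x, y, z) = D f (x, y, z) * g (x, y, z) + f (x, y, z) * D g (x, y, z)"
        if "(x, y, z) \<in> Danielewski p" for x y z
        using DERIV_unique[OF dir[OF polyfun_mult[OF FG(1,3)] that] DERIV_mult[OF dir[OF FG(1) that] dir[OF FG(3) that]]] that
        unfolding fg unfolding FG by (simp add: on_surface_def)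
      with off show ?thesis by (metis (no_types, lifting) ext add_0 mult_zero_left mult_zero_right prod_cases3)
    qed
    show "D (\<lambda>q. k * f q) = (\<lambda>q. k * D f q)" if "f \<in> coord_ring p" for k f
    proof -
      from that obtain F where F: "F \<in> polyfun" "f = on_surface p F"
        by (auto simp: coord_ring_def)
      then have kf: "(\<lambda>q. k * f q) = on_surface p (\<lambda>q. k * F q)" by (auto simp: on_surface_def)
      have "D (\<lambda>q. k * f q) (x, y, z) = k * D f (x, y, z)"
        if "(x, y, z) \<in> Danielewski p" for x y z
        using DERIV_unique[OF dir[OF polyfun_mult[OF polyfun_const F(1)] that] DERIV_cmult[OF dir[OF F(1) that]]]
        unfolding kf unfolding F .
      with off show ?thesis by (metis (no_types, lifting) ext mult_zero_right prod_cases3)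
    qed
  qed
  show "D (coord_x p) = on_surface p a" "D (coord_y p) = on_surface p b" "D (coord_z p) = on_surface p c"
    unfolding coord_x_def coord_y_def coord_z_def D[OF polyfun_x] D[OF polyfun_y] D[OF polyfun_z]
    by (simp_all add: partial_x_def partial_y_def partial_z_def case_prod_unfold)
qed

section \<open>The fields \<open>V\<close>, \<open>W\<close> and \<open>H\<close> as
  derivations\<close>

lemma field_V_alg: "field_V p \<in> alg_vfields p"
  and field_V_coords: "field_V p (coord_x p) = on_surface p (\<lambda>(x, y, z). poly (pderiv p) z)"
    "field_V p (coord_y p) = (\<lambda>_. 0)" "field_V p (coord_z p) = coord_y p"
proof -
  have 1: "field_V p (on_surface p F) = on_surface p (\<lambda>q. (case q of (x, y, z) \<Rightarrow> poly (pderiv p) z) * partial_x F q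
      + 0 * partial_y F q + (case q of (x, y, z) \<Rightarrow> y) * partial_z F q)" if "F \<in> polyfun" for F
    by (simp add: field_V_on_surface[OF that] case_prod_unfold)
  have 2: "field_V p f = (\<lambda>_. 0)" if "f \<notin> coord_ring p" for f
    using that by (simp add: field_V_def restricted_field_def)
  note ext = alg_vfield_of_extension[OF polyfun_poly_z polyfun_const polyfun_y 1 2, simplified]
  show "field_V p \<in> alg_vfields p"
    "field_V p (coord_x p) = on_surface p (\<lambda>(x, y, z). poly (pderiv p) z)"
    "field_V p (coord_y p) = (\<lambda>_. 0)" "field_V p (coord_z p) = coord_y p"
    using ext by (simp_all add: coord_y_def on_surface_def)
qed

lemma field_W_alg: "field_W p \<in> alg_vfields p"
  and field_W_coords: "field_W p (coord_x p) = (\<lambda>_. 0)"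
    "field_W p (coord_y p) = on_surface p (\<lambda>(x, y, z). poly (pderiv p) z)"
    "field_W p (coord_z p) = coord_x p"
proof -
  have 1: "field_W p (on_surface p F) = on_surface p (\<lambda>q. 0 * partial_x F q
      + (case q of (x, y, z) \<Rightarrow> poly (pderiv p) z) * partial_y F q + (case q of (x, y, z) \<Rightarrow> x) * partial_z F q)"
    if "F \<in> polyfun" for F
    by (simp add: field_W_on_surface[OF that] case_prod_unfold)
  have 2: "field_W p f = (\<lambda>_. 0)" if "f \<notin> coord_ring p" for f
    using that by (simp add: field_W_def restricted_field_def)
  note ext = alg_vfield_of_extension[OF polyfun_const polyfun_poly_z polyfun_x 1 2, simplified]
  show "field_W p \<in> alg_vfields p" "field_W p (coord_x p) = (\<lambda>_. 0)"
    "field_W p (coord_y p) = on_surface p (\<lambda>(x, y, z). poly (pderiv p) z)"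
    "field_W p (coord_z p) = coord_x p"
    using ext by (simp_all add: coord_x_def on_surface_def case_prod_unfold)
qed

lemma field_H_alg: "field_H p \<in> alg_vfields p"
  and field_H_coords: "field_H p (coord_x p) = (\<lambda>q. - coord_x p q)"
    "field_H p (coord_y p) = coord_y p" "field_H p (coord_z p) = (\<lambda>_. 0)"
proof -
  have 1: "field_H p (on_surface p F) = on_surface p (\<lambda>q. (-1 * (case q of (x, y, z) \<Rightarrow> x)) * partial_x F q
      + (case q of (x, y, z) \<Rightarrow> y) * partial_y F q + 0 * partial_z F q)" if "F \<in> polyfun" for F
    by (simp add: field_H_on_surface[OF that] case_prod_unfold)
  have 2: "field_H p f = (\<lambda>_. 0)" if "f \<notin> coord_ring p" for f
    using that by (simp add: field_H_def restricted_field_def)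
  note ext = alg_vfield_of_extension[OF polyfun_mult[OF polyfun_const polyfun_x] polyfun_y polyfun_const 1 2, simplified]
  show "field_H p \<in> alg_vfields p" "field_H p (coord_x p) = (\<lambda>q. - coord_x p q)"
    "field_H p (coord_y p) = coord_y p" "field_H p (coord_z p) = (\<lambda>_. 0)"
    using ext by (simp_all add: coord_x_def coord_y_def on_surface_def fun_eq_iff)
qed

section \<open>Volume-preserving fields\<close>

text \<open>Where \<open>x\<close> is nonzero, \<open>H\<close> and \<open>W\<close> span the
  tangent plane: \<open>H\<close> fixes \<open>z\<close> and \<open>W\<close> fixes
  \<open>x\<close>, so comparing coordinates gives \<open>x A = A(z) W - A(x) H\<close>. The factor
  \<open>x\<close> clears the denominators and makes the identity valid on the whole
  surface.\<close>

lemma alg_vfield_via_HW: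
  assumes A: "A \<in> alg_vfields p" and u: "u \<in> coord_ring p" and q: "(x, y, z) \<in> Danielewski p"
  shows "x * A u (x, y, z) =
    field_W p u (x, y, z) * A (coord_z p) (x, y, z) - field_H p u (x, y, z) * A (coord_x p) (x, y, z)"
proof -
  from u obtain F where F: "F \<in> polyfun" "u = on_surface p F" by (rule coord_ring_cases)
  have H: "field_H p u (x, y, z) = y * partial_y F (x, y, z) - x * partial_x F (x, y, z)"
    and W: "field_W p u (x, y, z) = poly (pderiv p) z * partial_y F (x, y, z) + x * partial_z F (x, y, z)"
    using q by (simp_all add: F(2) field_H_on_surface[OF F(1)] field_W_on_surface[OF F(1)])
      (simp_all add: on_surface_def)
  show ?thesis
    unfolding H W unfolding F(2) alg_vfield_chain[OF A F(1) q]
    using alg_vfield_tangent[OF A q] by algebra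
qed

section \<open>Bilinearity of the volume form and the Jacobi identity\<close>

lemma vol_form_vf_add_left:
  "vol_form p (vf_add A B) C = (\<lambda>q. vol_form p A C q + vol_form p B C q)"
  by (auto simp: vol_form_def on_surface_def wedge_d_def vf_add_def fun_eq_iff
      algebra_simps add_divide_distrib diff_divide_distrib)

lemma vol_form_swap: "vol_form p A B = (\<lambda>q. - vol_form p B A q)"
  by (auto simp: vol_form_def on_surface_def wedge_d_def fun_eq_iff minus_divide_left)

lemma vol_form_vf_add_right:
  "vol_form p C (vf_add A B) = (\<lambda>q. vol_form p C A q + vol_form p C B q)"
  by (simp add: vol_form_swap[of p C] vol_form_vf_add_left)

lemma vol_form_vf_scale_left: "vol_form p (vf_scale c A) B = (\<lambda>q. c * vol_form p A B q)"
  by (auto simp: vol_form_def on_surface_def wedge_d_def vf_scale_def vf_mult_def fun_eq_iff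
      algebra_simps diff_divide_distrib)

lemma vol_form_vf_scale_right: "vol_form p A (vf_scale c B) = (\<lambda>q. c * vol_form p A B q)"
  by (simp add: vol_form_swap[of p A] vol_form_vf_scale_left)

text \<open>The arrangement of the Jacobi identity that expands the Lie derivative along a
  bracket.\<close>

lemma lie_bracket_jacobi:
  assumes A: "A \<in> alg_vfields p" and B: "B \<in> alg_vfields p" and C: "C \<in> alg_vfields p"
  shows "lie_bracket (lie_bracket A B) C =
    vf_add (lie_bracket A (lie_bracket B C)) (vf_scale (-1) (lie_bracket B (lie_bracket A C)))"
proof (intro ext)
  fix f q
  show "lie_bracket (lie_bracket A B) C f q =
    vf_add (lie_bracket A (lie_bracket B C)) (vf_scale (-1) (lie_bracket B (lie_bracket A C))) f q"
  \<comment> \<open>The rules for derivations hold inside the coordinate ring; outside it every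
    bracket is 0 by convention.\<close>
  proof (cases "f \<in> coord_ring p")
    case True
    then show ?thesis
      by (simp add: lie_bracket_def vf_add_def vf_scale_def vf_mult_def alg_vfield_closed[OF A]
          alg_vfield_closed[OF B] alg_vfield_closed[OF C] alg_vfield_diff[OF A] alg_vfield_diff[OF B]
          alg_vfield_diff[OF C])
  next
    case False
    note out = alg_vfield_outside[OF lie_bracket_alg[OF _ C] False]
      alg_vfield_outside[OF lie_bracket_alg[OF _ lie_bracket_alg[OF _ C]] False]
    show ?thesis
      by (simp add: vf_add_def vf_scale_def vf_mult_def out(1)[OF lie_bracket_alg[OF A B]]
          out(2)[OF A B] out(2)[OF B A])
  qed
qed

locale smooth_danielewski =
  fixes p :: "complex poly"
  assumes nonconstant: "degree p > 0"
    and simple_zeros: "\<forall>z. poly p z = 0 \<longrightarrow> order z p = 1"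
begin

lemma p_nonzero: "p \<noteq> 0"
  using nonconstant by auto

lemma pderiv_at_root: "poly p z = 0 \<Longrightarrow> poly (pderiv p) z \<noteq> 0"
  using rsquarefree_roots[of p] simple_zeros p_nonzero order_root
  unfolding rsquarefree_def by metis

text \<open>Over the complex numbers a nonconstant common divisor of \<open>p\<close> and its
  derivative would have a root, and that root would be a multiple zero of \<open>p\<close>. The
  identity is what \<open>vol_form_regular\<close> requires.\<close>

lemma bezout:
  obtains a b where "a * p + b * pderiv p = 1"
proof -
  have "degree (gcd p (pderiv p)) = 0"
  proof (rule ccontr)
    assume "degree (gcd p (pderiv p)) \<noteq> 0"
    then obtain z where "poly (gcd p (pderiv p)) z = 0"
      using fundamental_theorem_of_algebra_alt[of "gcd p (pderiv p)"]
      by (metis degree_pCons_0)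
    then have "[:-z, 1:] dvd gcd p (pderiv p)" by (simp add: poly_eq_0_iff_dvd)
    then have "poly p z = 0" "poly (pderiv p) z = 0" by (simp_all add: poly_eq_0_iff_dvd)
    with pderiv_at_root show False by blast
  qed
  moreover have "gcd p (pderiv p) \<noteq> 0" using p_nonzero by simp
  ultimately have "is_unit (gcd p (pderiv p))" using is_unit_iff_degree by blast
  then have "coprime p (pderiv p)" by (meson coprimeI gcd_greatest dvd_unit_imp_unit)
  then have "fst (bezout_coefficients p (pderiv p)) * p + snd (bezout_coefficients p (pderiv p)) * pderiv p = 1"
    by (simp add: bezout_coefficients_fst_snd)
  then show ?thesis by (rule that)
qed

text \<open>The part of the surface with \<open>x\<close> nonzero is dense, so the vanishing extends
  by continuity: \<open>F1\<close> reaches the points with \<open>x = 0\<close> and \<open>y\<close>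
  nonzero, and from these \<open>F2\<close> reaches those with \<open>x = y = 0\<close>.\<close>

lemma coord_ring_eq_zeroI:
  assumes f: "f \<in> coord_ring p"
    and zero: "\<And>x y z. (x, y, z) \<in> Danielewski p \<Longrightarrow> x \<noteq> 0 \<Longrightarrow> f (x, y, z) = 0"
  shows "f = (\<lambda>_. 0)"
proof -
  from f obtain F where F: "F \<in> polyfun" "f = on_surface p F" by (rule coord_ring_cases)
  have F0: "F (x, y, z) = 0" if "(x, y, z) \<in> Danielewski p" "x \<noteq> 0" for x y z
    using zero[OF that] that by (simp add: F(2) on_surface_def)
  have lim: "g t = 0" if "(g has_field_derivative D) (at t)" "eventually (\<lambda>s. g s = 0) (at t)"
    for g :: "complex \<Rightarrow> complex" and D t
    using tendsto_unique[OF trivial_limit_at _ tendsto_eventually[OF that(2)]] DERIV_isCont[OF that(1)]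
    by (metis isCont_def)
  have F1: "F (0, y, z) = 0" if "poly p z = 0" "y \<noteq> 0" for y z
  proof -
    have "((\<lambda>s. F (poly p s / y, y, s)) has_field_derivative
        (poly (pderiv p) z / y * partial_x F (poly p z / y, y, z) + 0 * partial_y F (poly p z / y, y, z)
          + 1 * partial_z F (poly p z / y, y, z))) (at z)"
      using that by (intro polyfun_has_derivative_along[OF F(1)]) (auto intro!: derivative_eq_intros)
    \<comment> \<open>Without the other zeros of \<open>p\<close> there remains a neighbourhood of
      \<open>z\<close> in which the curve meets \<open>x = 0\<close> only at
      \<open>s = z\<close>.\<close>
    moreover have "open (- ({s. poly p s = 0} - {z}))"
      by (intro open_Compl finite_imp_closed finite_Diff poly_roots_finite p_nonzero)
    then have "eventually (\<lambda>s. F (poly p s / y, y, s) = 0) (at z)"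
      unfolding eventually_at_topological
      by (rule_tac exI[of _ "- ({s. poly p s = 0} - {z})"])
        (use that F0 in \<open>auto simp: Danielewski_def\<close>)
    ultimately show ?thesis using lim that by fastforce
  qed
  \<comment> \<open>At a zero \<open>z\<close> of \<open>p\<close> the whole line of points
    \<open>(0, s, z)\<close> lies on the surface, and \<open>F1\<close> covers it except at
    \<open>s = 0\<close>.\<close>
  have F2: "F (0, 0, z) = 0" if "poly p z = 0" for z
    by (rule lim[OF polyfun_DERIV_partial(2)[OF F(1)]])
      (use F1 that in \<open>auto simp: eventually_at_filter\<close>)
  have "F (x, y, z) = 0" if "(x, y, z) \<in> Danielewski p" for x y z
    using that F0 F1 F2 by (cases "x = 0"; cases "y = 0") (auto simp: Danielewski_def)
  then show ?thesis by (auto simp: F(2) on_surface_def)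
qed

lemma coord_ring_eqI:
  assumes "f \<in> coord_ring p" "g \<in> coord_ring p"
    and "\<And>x y z. (x, y, z) \<in> Danielewski p \<Longrightarrow> x \<noteq> 0 \<Longrightarrow> f (x, y, z) = g (x, y, z)"
  shows "f = g"
  using coord_ring_eq_zeroI[OF coord_ring_diff[OF assms(1,2)]] assms(3) by (simp add: fun_eq_iff)

text \<open>On the dense set where \<open>x\<close> is nonzero, \<open>x\<close> and
  \<open>z\<close> are local coordinates, and \<open>alg_vfield_via_HW\<close> recovers a derivation
  from its values on them.\<close>

lemma alg_vfield_eqI:
  assumes A: "A \<in> alg_vfields p" and B: "B \<in> alg_vfields p"
    and x: "A (coord_x p) = B (coord_x p)" and z: "A (coord_z p) = B (coord_z p)"
  shows "A = B"
proof
  fix f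
  show "A f = B f"
  proof (cases "f \<in> coord_ring p")
    case True
    show ?thesis
    proof (rule coord_ring_eqI)
      fix x y z assume q: "(x, y, z) \<in> Danielewski p" "x \<noteq> 0"
      then show "A f (x, y, z) = B f (x, y, z)"
        using alg_vfield_via_HW[OF A True q(1)] alg_vfield_via_HW[OF B True q(1)] assms(3,4) by (metis mult_left_cancel)
    qed (use A B True in \<open>simp_all add: alg_vfield_closed\<close>)
  qed (simp add: alg_vfield_outside[OF A] alg_vfield_outside[OF B])
qed

section \<open>The volume form and the divergence criterion\<close>

lemma vol_form_in_coord_ring:
  assumes "A \<in> alg_vfields p" "B \<in> alg_vfields p"
  shows "vol_form p A B \<in> coord_ring p"
proof -
  obtain a b where "a * p + b * pderiv p = 1" by (rule bezout)
  then show ?thesis by (rule vol_form_regular[OF assms])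
qed

text \<open>This is \<open>dx \<and> dz / x\<close> with its denominator cleared. Both sides are
  regular, so density carries the identity to the points with \<open>x = 0\<close>.\<close>

lemma x_vol_form:
  assumes A: "A \<in> alg_vfields p" and B: "B \<in> alg_vfields p"
  shows "(\<lambda>q. coord_x p q * vol_form p A B q) =
    (\<lambda>q. A (coord_x p) q * B (coord_z p) q - A (coord_z p) q * B (coord_x p) q)"
proof (rule coord_ring_eqI)
  fix x y z assume q: "(x, y, z) \<in> Danielewski p" "x \<noteq> 0"
  then show "coord_x p (x, y, z) * vol_form p A B (x, y, z) =
    A (coord_x p) (x, y, z) * B (coord_z p) (x, y, z) - A (coord_z p) (x, y, z) * B (coord_x p) (x, y, z)"
    using vol_form_eq(1)[OF A B q(1)] by (simp add: wedge_d_def)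
qed (auto intro!: coord_ring_mult coord_ring_diff vol_form_in_coord_ring alg_vfield_closed[OF A]
    alg_vfield_closed[OF B] A B)

text \<open>In the coordinates \<open>x, z\<close> the last factor is \<open>x\<close> times the divergence of \<open>\<Theta>\<close>.\<close>

lemma lie_derivative_vol_form:
  assumes T: "\<Theta> \<in> alg_vfields p" and A: "A \<in> alg_vfields p" and B: "B \<in> alg_vfields p"
    and q: "(x, y, z) \<in> Danielewski p"
  shows "x * (x * lie_derivative \<Theta> (vol_form p) A B (x, y, z)) = x * vol_form p A B (x, y, z) *
    (field_W p (\<Theta> (coord_z p)) (x, y, z) - field_H p (\<Theta> (coord_x p)) (x, y, z) - \<Theta> (coord_x p) (x, y, z))"
proof -
  let ?q = "(x, y, z)"
  note cl = alg_vfield_closed[OF A] alg_vfield_closed[OF B] alg_vfield_closed[OF T]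
    vol_form_in_coord_ring[OF A B] coord_ring_mult
  \<comment> \<open>Fact 1 applies \<open>\<Theta>\<close> to both sides of
    \<open>x_vol_form\<close>; facts 3 and 4 evaluate the two bracket terms. The second-order terms
    in \<open>\<Theta> (A _)\<close> and \<open>\<Theta> (B _)\<close> then cancel.\<close>
  have "\<Theta> (\<lambda>q. coord_x p q * vol_form p A B q) ?q =
      \<Theta> (\<lambda>q. A (coord_x p) q * B (coord_z p) q - A (coord_z p) q * B (coord_x p) q) ?q"
    unfolding x_vol_form[OF A B] ..
  then have 1: "\<Theta> (coord_x p) ?q * vol_form p A B ?q + x * \<Theta> (vol_form p A B) ?q =
      \<Theta> (A (coord_x p)) ?q * B (coord_z p) ?q + A (coord_x p) ?q * \<Theta> (B (coord_z p)) ?q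
      - (\<Theta> (A (coord_z p)) ?q * B (coord_x p) ?q + A (coord_z p) ?q * \<Theta> (B (coord_x p)) ?q)"
    using q by (simp add: alg_vfield_mult[OF T] alg_vfield_diff[OF T] cl)
  have 2: "x * vol_form p A B ?q = A (coord_x p) ?q * B (coord_z p) ?q - A (coord_z p) ?q * B (coord_x p) ?q"
    using fun_cong[OF x_vol_form[OF A B], of ?q] q by simp
  have 3: "x * vol_form p (lie_bracket \<Theta> A) B ?q =
      (\<Theta> (A (coord_x p)) ?q - A (\<Theta> (coord_x p)) ?q) * B (coord_z p) ?q
      - (\<Theta> (A (coord_z p)) ?q - A (\<Theta> (coord_z p)) ?q) * B (coord_x p) ?q"
    using fun_cong[OF x_vol_form[OF lie_bracket_alg[OF T A] B], of ?q] q by (simp add: lie_bracket_def)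
  have 4: "x * vol_form p A (lie_bracket \<Theta> B) ?q =
      A (coord_x p) ?q * (\<Theta> (B (coord_z p)) ?q - B (\<Theta> (coord_z p)) ?q)
      - A (coord_z p) ?q * (\<Theta> (B (coord_x p)) ?q - B (\<Theta> (coord_x p)) ?q)"
    using fun_cong[OF x_vol_form[OF A lie_bracket_alg[OF T B]], of ?q] q by (simp add: lie_bracket_def)
  \<comment> \<open>A second factor \<open>x\<close> is spent here: it lets \<open>A\<close> and
    \<open>B\<close>, applied to the components of \<open>\<Theta>\<close>, be expressed through
    \<open>W\<close> and \<open>H\<close>.\<close>
  note s = alg_vfield_via_HW[OF A alg_vfield_closed[OF T coord_ring_coords(1)] q]
    alg_vfield_via_HW[OF A alg_vfield_closed[OF T coord_ring_coords(3)] q]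
    alg_vfield_via_HW[OF B alg_vfield_closed[OF T coord_ring_coords(1)] q]
    alg_vfield_via_HW[OF B alg_vfield_closed[OF T coord_ring_coords(3)] q]
  have "x * lie_derivative \<Theta> (vol_form p) A B ?q =
      (\<Theta> (coord_x p) ?q * vol_form p A B ?q + x * \<Theta> (vol_form p A B) ?q)
      - \<Theta> (coord_x p) ?q * vol_form p A B ?q
      - x * vol_form p (lie_bracket \<Theta> A) B ?q - x * vol_form p A (lie_bracket \<Theta> B) ?q"
    by (simp add: lie_derivative_def right_diff_distrib)
  also have "\<dots> = A (\<Theta> (coord_x p)) ?q * B (coord_z p) ?q - A (\<Theta> (coord_z p)) ?q * B (coord_x p) ?q
      + A (coord_x p) ?q * B (\<Theta> (coord_z p)) ?q - A (coord_z p) ?q * B (\<Theta> (coord_x p)) ?q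
      - \<Theta> (coord_x p) ?q * vol_form p A B ?q"
    unfolding 1 3 4 by (simp add: algebra_simps)
  finally have "x * (x * lie_derivative \<Theta> (vol_form p) A B ?q) =
      (x * A (\<Theta> (coord_x p)) ?q) * B (coord_z p) ?q - (x * A (\<Theta> (coord_z p)) ?q) * B (coord_x p) ?q
      + A (coord_x p) ?q * (x * B (\<Theta> (coord_z p)) ?q) - A (coord_z p) ?q * (x * B (\<Theta> (coord_x p)) ?q)
      - \<Theta> (coord_x p) ?q * (x * vol_form p A B ?q)"
    by (simp only: right_diff_distrib distrib_left mult_ac)
  then show ?thesis
    unfolding 2 s by (simp add: algebra_simps)
qed

text \<open>By \<open>lie_derivative_vol_form\<close> the Lie derivative is a divergence times
  \<open>\<omega>\<close>, up to powers of \<open>x\<close> that cancel on a dense set. So a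
  condition on all pairs of fields becomes one equation between regular functions.\<close>

lemma volume_preserving_iff:
  assumes T: "\<Theta> \<in> alg_vfields p"
  shows "volume_preserving p \<Theta> \<longleftrightarrow>
    \<Theta> (coord_x p) = (\<lambda>q. field_W p (\<Theta> (coord_z p)) q - field_H p (\<Theta> (coord_x p)) q)"
proof
  assume vp: "volume_preserving p \<Theta>"
  show "\<Theta> (coord_x p) = (\<lambda>q. field_W p (\<Theta> (coord_z p)) q - field_H p (\<Theta> (coord_x p)) q)"
  proof (rule coord_ring_eqI)
    fix x y z assume q: "(x, y, z) \<in> Danielewski p" "x \<noteq> 0"
    \<comment> \<open>Since \<open>\<omega>(W, H) = x\<close> is nonzero here, this single pair
      detects the divergence.\<close>
    have "x * vol_form p (field_W p) (field_H p) (x, y, z) = x * x"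
      using fun_cong[OF x_vol_form[OF field_W_alg field_H_alg], of "(x, y, z)"] q
      by (simp add: field_W_coords field_H_coords)
    moreover have "lie_derivative \<Theta> (vol_form p) (field_W p) (field_H p) (x, y, z) = 0"
      using vp field_W_alg field_H_alg by (simp add: volume_preserving_def)
    ultimately show "\<Theta> (coord_x p) (x, y, z) =
        field_W p (\<Theta> (coord_z p)) (x, y, z) - field_H p (\<Theta> (coord_x p)) (x, y, z)"
      using lie_derivative_vol_form[OF T field_W_alg field_H_alg q(1)] q(2) by simp
  qed (auto intro!: coord_ring_diff alg_vfield_closed[OF T] alg_vfield_closed[OF field_W_alg]
      alg_vfield_closed[OF field_H_alg])
next
  assume div: "\<Theta> (coord_x p) = (\<lambda>q. field_W p (\<Theta> (coord_z p)) q - field_H p (\<Theta> (coord_x p)) q)"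
  show "volume_preserving p \<Theta>"
    unfolding volume_preserving_def
  proof (intro ballI coord_ring_eq_zeroI)
    fix A B assume A: "A \<in> alg_vfields p" and B: "B \<in> alg_vfields p"
    show "lie_derivative \<Theta> (vol_form p) A B \<in> coord_ring p"
      unfolding lie_derivative_def
      by (intro coord_ring_diff alg_vfield_closed[OF T] vol_form_in_coord_ring lie_bracket_alg A B T)
    fix x y z assume "(x, y, z) \<in> Danielewski p" "x \<noteq> 0"
    then show "lie_derivative \<Theta> (vol_form p) A B (x, y, z) = 0"
      using lie_derivative_vol_form[OF T A B, of x y z] fun_cong[OF div, of "(x, y, z)"] by simp
  qed
qed

section \<open>The volume-preserving fields form a Lie algebra\<close>

lemma vp_zero: "vf_zero \<in> vp_alg_vfields p"
  by (simp add: vp_alg_vfields_def vf_zero_alg volume_preserving_iff)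
    (simp add: vf_zero_def alg_vfield_zero[OF field_W_alg] alg_vfield_zero[OF field_H_alg])

lemma vp_add:
  assumes "A \<in> vp_alg_vfields p" "B \<in> vp_alg_vfields p"
  shows "vf_add A B \<in> vp_alg_vfields p"
proof -
  have AB: "A \<in> alg_vfields p" "B \<in> alg_vfields p" using assms by (simp_all add: vp_alg_vfields_def)
  with assms have div: "A (coord_x p) q = field_W p (A (coord_z p)) q - field_H p (A (coord_x p)) q"
    "B (coord_x p) q = field_W p (B (coord_z p)) q - field_H p (B (coord_x p)) q" for q
    by (auto simp: vp_alg_vfields_def volume_preserving_iff dest: fun_cong[of _ _ q])
  have "vf_add A B (coord_x p) q =
      field_W p (vf_add A B (coord_z p)) q - field_H p (vf_add A B (coord_x p)) q" for q
    using div[of q] by (simp add: vf_add_def alg_vfield_add[OF field_W_alg] alg_vfield_add[OF field_H_alg]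
        alg_vfield_closed AB)
  then have "vf_add A B (coord_x p) =
      (\<lambda>q. field_W p (vf_add A B (coord_z p)) q - field_H p (vf_add A B (coord_x p)) q)" ..
  with AB show ?thesis by (simp add: vp_alg_vfields_def volume_preserving_iff vf_add_alg)
qed

lemma vp_scale:
  assumes "A \<in> vp_alg_vfields p"
  shows "vf_scale c A \<in> vp_alg_vfields p"
proof -
  have A: "A \<in> alg_vfields p" using assms by (simp add: vp_alg_vfields_def)
  with assms have div: "A (coord_x p) q = field_W p (A (coord_z p)) q - field_H p (A (coord_x p)) q" for q
    by (auto simp: vp_alg_vfields_def volume_preserving_iff dest: fun_cong[of _ _ q])
  have "vf_scale c A (coord_x p) q =
      field_W p (vf_scale c A (coord_z p)) q - field_H p (vf_scale c A (coord_x p)) q" for q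
    using div[of q] by (simp add: vf_scale_def vf_mult_def alg_vfield_scale[OF field_W_alg]
        alg_vfield_scale[OF field_H_alg] alg_vfield_closed A right_diff_distrib)
  then have "vf_scale c A (coord_x p) =
      (\<lambda>q. field_W p (vf_scale c A (coord_z p)) q - field_H p (vf_scale c A (coord_x p)) q)" ..
  with A show ?thesis by (simp add: vp_alg_vfields_def volume_preserving_iff vf_scale_alg)
qed

text \<open>The Lie derivative along a bracket is the commutator of the two Lie derivatives, both of
  which annihilate \<open>\<omega>\<close>.\<close>

lemma vp_bracket:
  assumes A: "A \<in> vp_alg_vfields p" and B: "B \<in> vp_alg_vfields p"
  shows "lie_bracket A B \<in> vp_alg_vfields p"
proof -
  have AB: "A \<in> alg_vfields p" "B \<in> alg_vfields p" using assms by (simp_all add: vp_alg_vfields_def)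
  have inv: "T (vol_form p C D) = (\<lambda>q. vol_form p (lie_bracket T C) D q + vol_form p C (lie_bracket T D) q)"
    if "T \<in> vp_alg_vfields p" "C \<in> alg_vfields p" "D \<in> alg_vfields p" for T C D
  proof -
    have "lie_derivative T (vol_form p) C D = (\<lambda>_. 0)"
      using that by (simp add: vp_alg_vfields_def volume_preserving_def)
    then show ?thesis by (simp add: lie_derivative_def fun_eq_iff algebra_simps)
  qed
  have "lie_derivative (lie_bracket A B) (vol_form p) C D q = 0"
    if CD: "C \<in> alg_vfields p" "D \<in> alg_vfields p" for C D q
  proof -
    \<comment> \<open>Invariance is a Leibniz rule for a field acting on
      \<open>\<omega>(C, D)\<close>, applied here twice. The two mixed terms are symmetric in
      \<open>S\<close> and \<open>T\<close>, so they drop out of the commutator; the Jacobi identity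
      matches the others.\<close>
    have iter: "S (T (vol_form p C D)) = (\<lambda>q. vol_form p (lie_bracket S (lie_bracket T C)) D q
        + vol_form p (lie_bracket T C) (lie_bracket S D) q + (vol_form p (lie_bracket S C) (lie_bracket T D) q
        + vol_form p C (lie_bracket S (lie_bracket T D)) q))"
      if ST: "S \<in> vp_alg_vfields p" "T \<in> vp_alg_vfields p" for S T
    proof -
      have ST': "S \<in> alg_vfields p" "T \<in> alg_vfields p" using ST by (simp_all add: vp_alg_vfields_def)
      show ?thesis
        unfolding inv[OF ST(2) CD]
        by (simp add: alg_vfield_add[OF ST'(1)] vol_form_in_coord_ring lie_bracket_alg CD ST' inv[OF ST(1)])
    qed
    show ?thesis
      unfolding lie_derivative_def lie_bracket_jacobi[OF AB CD(1)] lie_bracket_jacobi[OF AB CD(2)]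
        vol_form_vf_add_left vol_form_vf_add_right vol_form_vf_scale_left vol_form_vf_scale_right
      unfolding lie_bracket_def[of A B] iter[OF A B] iter[OF B A] by simp
  qed
  then show ?thesis
    using AB by (auto simp: vp_alg_vfields_def volume_preserving_def lie_bracket_alg fun_eq_iff)
qed

end

section \<open>Monomials\<close>

lemma Danielewski_eq: "(x, y, z) \<in> Danielewski p \<Longrightarrow> poly p z = x * y"
  by (simp add: Danielewski_def)

definition monom_fun :: "nat \<Rightarrow> nat \<Rightarrow> complex poly \<Rightarrow> point \<Rightarrow> complex" where
  "monom_fun i j g = (\<lambda>(x, y, z). x ^ i * y ^ j * poly g z)"

lemma monom_fun_polyfun: "monom_fun i j g \<in> polyfun"
  unfolding monom_fun_def by (rule polyfun_monomial)

text \<open>Every polynomial function is a finite sum of monomials with coefficients in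
  \<open>z\<close>, so additive properties need checking only on these.\<close>

lemma polyfun_monomial_induct:
  assumes "F \<in> polyfun"
    and "\<And>u v. P u \<Longrightarrow> P v \<Longrightarrow> P (\<lambda>q. u q + v q)"
    and "\<And>i j g. P (monom_fun i j g)"
  shows "P F"
proof -
  \<comment> \<open>Two strengthenings: a monomial factor in front absorbs the coordinates, and
    quantifying over \<open>P\<close> inside the induction serves the product case.\<close>
  have "\<forall>P. (\<forall>u v. P u \<longrightarrow> P v \<longrightarrow> P (\<lambda>q. u q + v q)) \<longrightarrow> (\<forall>i j g. P (monom_fun i j g)) \<longrightarrow>
      (\<forall>i j g. P (\<lambda>q. monom_fun i j g q * F q))"
    using assms(1)
  proof induction
    case (polyfun_const c)
    have "(\<lambda>q. monom_fun i j g q * c) = monom_fun i j (smult c g)" for i j g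
      by (auto simp: monom_fun_def)
    then show ?case by simp
  next
    case polyfun_x
    have eq: "(\<lambda>q. monom_fun i j g q * (\<lambda>(x, y, z). x) q) = monom_fun (Suc i) j g" for i j g
      by (auto simp: monom_fun_def)
    show ?case unfolding eq by blast
  next
    case polyfun_y
    have eq: "(\<lambda>q. monom_fun i j g q * (\<lambda>(x, y, z). y) q) = monom_fun i (Suc j) g" for i j g
      by (auto simp: monom_fun_def)
    show ?case unfolding eq by blast
  next
    case polyfun_z
    have eq: "(\<lambda>q. monom_fun i j g q * (\<lambda>(x, y, z). z) q) = monom_fun i j ([:0, 1:] * g)" for i j g
      by (auto simp: monom_fun_def)
    show ?case unfolding eq by blast
  next
    case (polyfun_add F G)
    show ?case
    proof (intro allI impI)
      fix P :: "(point \<Rightarrow> complex) \<Rightarrow> bool" and i j g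
      assume P: "\<forall>u v. P u \<longrightarrow> P v \<longrightarrow> P (\<lambda>q. u q + v q)" "\<forall>i j g. P (monom_fun i j g)"
      with polyfun_add.IH have "P (\<lambda>q. monom_fun i j g q * F q)" "P (\<lambda>q. monom_fun i j g q * G q)"
        by blast+
      with P(1) show "P (\<lambda>q. monom_fun i j g q * (F q + G q))" by (simp add: distrib_left)
    qed
  next
    case (polyfun_mult F G)
    show ?case
    proof (intro allI impI)
      fix P :: "(point \<Rightarrow> complex) \<Rightarrow> bool" and i j g
      assume P: "\<forall>u v. P u \<longrightarrow> P v \<longrightarrow> P (\<lambda>q. u q + v q)" "\<forall>i j g. P (monom_fun i j g)"
      have "\<forall>i j g. P (\<lambda>q. monom_fun i j g q * G q)"
        using polyfun_mult.IH(2) P by blast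
      \<comment> \<open>The hypothesis for \<open>F\<close> is used with the predicate
        "\<open>P\<close> holds after multiplication by \<open>G\<close>", which the hypothesis for
        \<open>G\<close> establishes on monomials.\<close>
      with P(1) have "P (\<lambda>q. (monom_fun i j g q * F q) * G q)"
        using polyfun_mult.IH(1)[rule_format, of "\<lambda>u. P (\<lambda>q. u q * G q)" i j g]
        by (simp add: distrib_right)
      then show "P (\<lambda>q. monom_fun i j g q * (F q * G q))"
        by (simp add: mult.assoc)
    qed
  qed
  from this[rule_format, of P 0 0 1] assms(2,3) show ?thesis
    by (simp add: monom_fun_def case_prod_unfold)
qed

text \<open>A linear subspace with an element of every degree is the whole space: leading terms are
  cancelled one after another.\<close>

lemma poly_additive_induct:
  fixes P :: "'a :: field poly \<Rightarrow> bool"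
  assumes zero: "P 0"
    and add: "\<And>f g. P f \<Longrightarrow> P g \<Longrightarrow> P (f + g)"
    and smult: "\<And>c f. P f \<Longrightarrow> P (smult c f)"
    and deg: "\<And>n. \<exists>q. q \<noteq> 0 \<and> degree q = n \<and> P q"
  shows "P g"
proof (induction "degree g" arbitrary: g rule: less_induct)
  case less
  from deg[of "degree g"] obtain q where q: "q \<noteq> 0" "degree q = degree g" "P q" by blast
  define c where "c = lead_coeff g / lead_coeff q"
  define r where "r = g - smult c q"
  have "coeff r (degree g) = 0"
    using q by (simp add: r_def c_def) (metis leading_coeff_0_iff nonzero_eq_divide_eq)
  moreover have "degree r \<le> degree g"
    unfolding r_def using q by (intro degree_diff_le) (auto intro: order.trans[OF degree_smult_le])
  ultimately have "r = 0 \<or> degree r < degree g"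
    by (metis leading_coeff_0_iff le_neq_implies_less)
  then have "P r" using less zero by blast
  from add[OF this smult[OF q(3), of c]] show ?case by (simp add: r_def)
qed

text \<open>The curve \<open>x = 1\<close> in the surface is a section of the projection to
  \<open>z\<close>. Restriction to it later produces the coefficient of a field
  \<open>g(z) H\<close>.\<close>

lemma polyfun_on_section:
  assumes "F \<in> polyfun"
  obtains g where "\<And>z. poly g z = F (1, poly p z, z)"
proof -
  from assms have "\<exists>g. \<forall>z. poly g z = F (1, poly p z, z)"
  proof induction
    case (polyfun_const c)
    show ?case by (rule exI[of _ "[:c:]"]) simp
  next
    case polyfun_x
    show ?case by (rule exI[of _ 1]) simp
  next
    case polyfun_y
    show ?case by (rule exI[of _ p]) simp
  next
    case polyfun_z
    show ?case by (rule exI[of _ "[:0, 1:]"]) simp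
  next
    case (polyfun_add F G)
    then show ?case by (metis poly_add)
  next
    case (polyfun_mult F G)
    then show ?case by (metis poly_mult)
  qed
  with that show ?thesis by blast
qed

definition surface_monom :: "complex poly \<Rightarrow> nat \<Rightarrow> nat \<Rightarrow> complex poly \<Rightarrow> point \<Rightarrow> complex" where
  "surface_monom p i j g = on_surface p (monom_fun i j g)"

lemma surface_monom_coord_ring [simp]: "surface_monom p i j g \<in> coord_ring p"
  unfolding surface_monom_def by (intro on_surface_coord_ring monom_fun_polyfun)

lemma surface_monom_at [simp]: "(x, y, z) \<in> Danielewski p \<Longrightarrow> surface_monom p i j g (x, y, z) = x ^ i * y ^ j * poly g z"
  by (simp add: surface_monom_def on_surface_def monom_fun_def)

lemma alg_vfield_surface_monom:
  assumes D: "D \<in> alg_vfields p" and q: "(x, y, z) \<in> Danielewski p"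
  shows "D (surface_monom p i j g) (x, y, z) =
    of_nat i * x ^ (i - 1) * y ^ j * poly g z * D (coord_x p) (x, y, z)
    + of_nat j * x ^ i * y ^ (j - 1) * poly g z * D (coord_y p) (x, y, z)
    + x ^ i * y ^ j * poly (pderiv g) z * D (coord_z p) (x, y, z)"
proof -
  have "partial_x (monom_fun i j g) (x, y, z) = of_nat i * x ^ (i - 1) * y ^ j * poly g z"
    "partial_y (monom_fun i j g) (x, y, z) = of_nat j * x ^ i * y ^ (j - 1) * poly g z"
    "partial_z (monom_fun i j g) (x, y, z) = x ^ i * y ^ j * poly (pderiv g) z"
    unfolding partial_x_def partial_y_def partial_z_def monom_fun_def prod.case
    by (rule DERIV_imp_deriv, auto intro!: derivative_eq_intros)+
  then show ?thesis
    unfolding surface_monom_def alg_vfield_chain[OF D monom_fun_polyfun q] by (simp add: algebra_simps)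
qed

lemma coord_ring_ext:
  assumes "f \<in> coord_ring p" "g \<in> coord_ring p"
    and "\<And>x y z. (x, y, z) \<in> Danielewski p \<Longrightarrow> f (x, y, z) = g (x, y, z)"
  shows "f = g"
proof
  fix q show "f q = g q"
    using assms coord_ring_off[OF assms(1), of q] coord_ring_off[OF assms(2), of q]
    by (cases q; cases "q \<in> Danielewski p") auto
qed

section \<open>Hamiltonian vector fields\<close>

text \<open>Up to sign, the Hamiltonian vector fields of \<open>y\<^sup>n\<^sup>+\<^sup>1 g(z)\<close>, \<open>x\<^sup>n\<^sup>+\<^sup>1 g(z)\<close>
  and of a primitive of \<open>g(z)\<close>.\<close>

definition ham_y :: "complex poly \<Rightarrow> nat \<Rightarrow> complex poly \<Rightarrow> vfield" where
  "ham_y p n g = vf_add (vf_mult (monom_fun 0 n (smult (of_nat (Suc n)) g)) (field_V p))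
     (vf_mult (monom_fun 0 (Suc n) (- pderiv g)) (field_H p))"

definition ham_x :: "complex poly \<Rightarrow> nat \<Rightarrow> complex poly \<Rightarrow> vfield" where
  "ham_x p n g = vf_add (vf_mult (monom_fun n 0 (smult (of_nat (Suc n)) g)) (field_W p))
     (vf_mult (monom_fun (Suc n) 0 (pderiv g)) (field_H p))"

definition ham_z :: "complex poly \<Rightarrow> complex poly \<Rightarrow> vfield" where
  "ham_z p g = vf_mult (monom_fun 0 0 g) (field_H p)"

lemma ham_alg: "ham_y p n g \<in> alg_vfields p" "ham_x p n g \<in> alg_vfields p" "ham_z p g \<in> alg_vfields p"
  unfolding ham_y_def ham_x_def ham_z_def
  by (intro vf_add_alg vf_mult_alg monom_fun_polyfun field_V_alg field_W_alg field_H_alg)+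

text \<open>The relation \<open>x y = p(z)\<close> merges the contributions of \<open>V\<close> and
  \<open>H\<close> to the \<open>x\<close>-component, so each value is a single monomial in
  \<open>y\<close> with a coefficient in \<open>z\<close>.\<close>

lemma ham_y_coords:
  "ham_y p n g (coord_x p) = surface_monom p 0 n (smult (of_nat (Suc n)) (g * pderiv p) + p * pderiv g)"
  "ham_y p n g (coord_y p) = surface_monom p 0 (Suc (Suc n)) (- pderiv g)"
  "ham_y p n g (coord_z p) = surface_monom p 0 (Suc n) (smult (of_nat (Suc n)) g)"
  by (rule coord_ring_ext[OF alg_vfield_closed[OF ham_alg(1)]]; simp;
      simp add: ham_y_def vf_add_def vf_mult_def field_V_coords field_H_coords monom_fun_def;
      simp add: on_surface_def Danielewski_def algebra_simps)+

lemma ham_x_coords: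
  "ham_x p n g (coord_x p) = surface_monom p (Suc (Suc n)) 0 (- pderiv g)"
  "ham_x p n g (coord_y p) = surface_monom p n 0 (smult (of_nat (Suc n)) (g * pderiv p) + p * pderiv g)"
  "ham_x p n g (coord_z p) = surface_monom p (Suc n) 0 (smult (of_nat (Suc n)) g)"
  by (rule coord_ring_ext[OF alg_vfield_closed[OF ham_alg(2)]]; simp;
      simp add: ham_x_def vf_add_def vf_mult_def field_W_coords field_H_coords monom_fun_def;
      simp add: on_surface_def Danielewski_def algebra_simps)+

lemma ham_z_coords:
  "ham_z p g (coord_x p) = surface_monom p 1 0 (- g)"
  "ham_z p g (coord_y p) = surface_monom p 0 1 g"
  "ham_z p g (coord_z p) = surface_monom p 0 0 0"
  by (rule coord_ring_ext[OF alg_vfield_closed[OF ham_alg(3)]]; simp;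
      simp add: ham_z_def vf_add_def vf_mult_def field_V_coords field_H_coords monom_fun_def;
      simp add: on_surface_def Danielewski_def algebra_simps)+

lemma ham_add:
  "ham_y p n (g + h) = vf_add (ham_y p n g) (ham_y p n h)"
  "ham_x p n (g + h) = vf_add (ham_x p n g) (ham_x p n h)"
  "ham_z p (g + h) = vf_add (ham_z p g) (ham_z p h)"
  by (auto simp: ham_y_def ham_x_def ham_z_def vf_add_def vf_mult_def monom_fun_def fun_eq_iff
      pderiv_add algebra_simps)

lemma ham_smult:
  "ham_y p n (smult c g) = vf_scale c (ham_y p n g)"
  "ham_x p n (smult c g) = vf_scale c (ham_x p n g)"
  "ham_z p (smult c g) = vf_scale c (ham_z p g)"
  by (auto simp: ham_y_def ham_x_def ham_z_def vf_add_def vf_scale_def vf_mult_def monom_fun_def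
      fun_eq_iff pderiv_smult algebra_simps)

lemma ham_zero: "ham_y p n 0 = vf_zero" "ham_x p n 0 = vf_zero" "ham_z p 0 = vf_zero"
  by (auto simp: ham_y_def ham_x_def ham_z_def vf_add_def vf_zero_def vf_mult_def monom_fun_def
      fun_eq_iff)

text \<open>The constant \<open>1 / (n + 1)\<close> cancels the factor from differentiating a power
  of exponent \<open>n + 1\<close>.\<close>

lemma ham_generators:
  "ham_y p n [:1 / of_nat (Suc n):] = vf_mult (\<lambda>(x, y, z). y ^ n) (field_V p)"
  "ham_x p n [:1 / of_nat (Suc n):] = vf_mult (\<lambda>(x, y, z). x ^ n) (field_W p)"
  "ham_z p (monom 1 m) = vf_mult (\<lambda>(x, y, z). z ^ m) (field_H p)"
  by (auto simp: ham_y_def ham_x_def ham_z_def vf_add_def vf_mult_def monom_fun_def fun_eq_iff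
      poly_monom simp del: of_nat_Suc)

context smooth_danielewski
begin

lemma ham_vp: "ham_y p n g \<in> vp_alg_vfields p" "ham_x p n g \<in> vp_alg_vfields p"
  "ham_z p g \<in> vp_alg_vfields p"
proof -
  have "D \<in> vp_alg_vfields p"
    if D: "D \<in> alg_vfields p" "\<And>x y z. (x, y, z) \<in> Danielewski p \<Longrightarrow> poly p z = x * y \<Longrightarrow>
      D (coord_x p) (x, y, z) = field_W p (D (coord_z p)) (x, y, z) - field_H p (D (coord_x p)) (x, y, z)" for D
  proof -
    have "D (coord_x p) = (\<lambda>q. field_W p (D (coord_z p)) q - field_H p (D (coord_x p)) q)"
      by (rule coord_ring_ext[where p = p]) (simp_all add: coord_ring_diff alg_vfield_closed[OF field_W_alg]
          alg_vfield_closed[OF field_H_alg] alg_vfield_closed[OF D(1)] D(2) Danielewski_eq)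
    then show ?thesis using D(1) by (simp add: vp_alg_vfields_def volume_preserving_iff)
  qed
  note I = this
  note simps = alg_vfield_surface_monom[OF field_W_alg] alg_vfield_surface_monom[OF field_H_alg] field_W_coords
    field_H_coords on_surface_def
  \<comment> \<open>The case split on \<open>n\<close> resolves the truncated exponent
    \<open>n - 1\<close> that comes from differentiating \<open>y ^ n\<close>.\<close>
  show "ham_y p n g \<in> vp_alg_vfields p"
    by (rule I[OF ham_alg(1)]; cases n; simp add: ham_y_coords simps)
      (simp_all add: pderiv_add pderiv_mult pderiv_smult algebra_simps)
  show "ham_x p n g \<in> vp_alg_vfields p"
    by (rule I[OF ham_alg(2)]; simp add: ham_x_coords simps) (simp add: pderiv_smult algebra_simps)
  show "ham_z p g \<in> vp_alg_vfields p"
    by (rule I[OF ham_alg(3)]; simp add: ham_z_coords simps)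
qed

text \<open>Up to sign these are Poisson brackets of the Hamiltonians, checked on \<open>x\<close>
  and \<open>z\<close> only. The argument of \<open>ham_z\<close> is the derivative of its
  Hamiltonian, so \<open>{x g, y} = (p g)'\<close> shows up as a second derivative.\<close>

lemma ham_brackets:
  "lie_bracket (ham_z p g) (ham_y p n h) = vf_scale (of_nat (Suc n)) (ham_y p n (g * h))"
  "lie_bracket (ham_z p g) (ham_x p n h) = vf_scale (- of_nat (Suc n)) (ham_x p n (g * h))"
  "lie_bracket (ham_x p 0 g) (ham_y p 0 1) = vf_scale (- 1) (ham_z p (pderiv (pderiv (p * g))))"
  "lie_bracket (ham_y p 0 [:0, 1:]) (ham_y p n 1) = vf_scale (- of_nat (Suc n)) (ham_y p (Suc n) 1)"
  "lie_bracket (ham_x p 0 [:0, 1:]) (ham_x p n 1) = vf_scale (- of_nat (Suc n)) (ham_x p (Suc n) 1)"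
proof -
  have I: "A = B" if "A \<in> alg_vfields p" "B \<in> alg_vfields p"
    "\<And>x y z. (x, y, z) \<in> Danielewski p \<Longrightarrow> poly p z = x * y \<Longrightarrow> A (coord_x p) (x, y, z) = B (coord_x p) (x, y, z)"
    "\<And>x y z. (x, y, z) \<in> Danielewski p \<Longrightarrow> poly p z = x * y \<Longrightarrow> A (coord_z p) (x, y, z) = B (coord_z p) (x, y, z)" for A B
    by (intro alg_vfield_eqI coord_ring_ext[where p = p])
      (simp_all add: that alg_vfield_closed[OF that(1)] alg_vfield_closed[OF that(2)] Danielewski_eq)
  note simps = lie_bracket_def vf_scale_def vf_mult_def ham_y_coords ham_x_coords ham_z_coords
    alg_vfield_surface_monom[OF ham_alg(1)] alg_vfield_surface_monom[OF ham_alg(2)] alg_vfield_surface_monom[OF ham_alg(3)]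
  note poly_simps = pderiv_add pderiv_mult pderiv_smult pderiv_minus pderiv_pCons
  show "lie_bracket (ham_z p g) (ham_y p n h) = vf_scale (of_nat (Suc n)) (ham_y p n (g * h))"
    by (rule I; (intro lie_bracket_alg vf_scale_alg ham_alg)?; cases n; simp add: simps)
      (simp_all add: poly_simps algebra_simps)
  show "lie_bracket (ham_z p g) (ham_x p n h) = vf_scale (- of_nat (Suc n)) (ham_x p n (g * h))"
    by (rule I; (intro lie_bracket_alg vf_scale_alg ham_alg)?; cases n; simp add: simps)
      (simp_all add: poly_simps algebra_simps)
  show "lie_bracket (ham_x p 0 g) (ham_y p 0 1) = vf_scale (- 1) (ham_z p (pderiv (pderiv (p * g))))"
    by (rule I; (intro lie_bracket_alg vf_scale_alg ham_alg)?; simp add: simps)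
      (simp_all add: poly_simps algebra_simps)
  show "lie_bracket (ham_y p 0 [:0, 1:]) (ham_y p n 1) = vf_scale (- of_nat (Suc n)) (ham_y p (Suc n) 1)"
    by (rule I; (intro lie_bracket_alg vf_scale_alg ham_alg)?; cases n; simp add: simps)
      (simp_all add: poly_simps algebra_simps)
  show "lie_bracket (ham_x p 0 [:0, 1:]) (ham_x p n 1) = vf_scale (- of_nat (Suc n)) (ham_x p (Suc n) 1)"
    by (rule I; (intro lie_bracket_alg vf_scale_alg ham_alg)?; cases n; simp add: simps)
      (simp_all add: poly_simps algebra_simps)
qed

end

text \<open>Repeated use removes \<open>x\<close> or \<open>y\<close> from any monomial.\<close>

lemma surface_monom_Suc_Suc: "surface_monom p (Suc i) (Suc j) g = surface_monom p i j (p * g)"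
  by (rule coord_ring_ext[where p = p]) (auto simp: Danielewski_eq algebra_simps)

section \<open>The generated Lie algebra\<close>

context smooth_danielewski
begin

abbreviation gen :: "vfield set" where
  "gen \<equiv> lie_algebra_generated (vp_generators p)"

text \<open>By linearity of \<open>D\<close>, the coefficients with \<open>D q\<close> in the
  generated algebra form a subspace, so one of each degree suffices.\<close>

lemma ham_in_gen_induct:
  assumes "\<And>f g. D (f + g) = vf_add (D f) (D g)" "\<And>c f. D (smult c f) = vf_scale c (D f)"
    and "D 0 = vf_zero" and "\<And>n. \<exists>q. q \<noteq> 0 \<and> degree q = n \<and> D q \<in> gen"
  shows "D g \<in> gen"
  by (rule poly_additive_induct[of "\<lambda>g. D g \<in> gen"])
    (simp_all only: assms lie_gen_zero lie_gen_add lie_gen_scale)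

lemma gen_scaleD:
  assumes "vf_scale c A \<in> gen" "c \<noteq> 0"
  shows "A \<in> gen"
  using lie_gen_scale[OF assms(1), of "1 / c"] assms(2) by (simp add: vf_scale_def vf_mult_def)

lemma generators_in_gen:
  "n \<le> max 1 (degree p - 3) \<Longrightarrow> ham_y p n [:1 / of_nat (Suc n):] \<in> gen"
  "n \<le> max 1 (degree p - 3) \<Longrightarrow> ham_x p n [:1 / of_nat (Suc n):] \<in> gen"
  "m \<le> max 2 (degree p - 3) \<Longrightarrow> ham_z p (monom 1 m) \<in> gen"
  unfolding ham_generators by (rule lie_gen_base, (simp only: vp_generators_def)[1], blast)+

text \<open>Bracketing with \<open>z H\<close> multiplies the coefficient by \<open>z\<close>, up to
  sign; the induction starts from \<open>V\<close> and \<open>W\<close>.\<close>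

lemma ham_0_in_gen: "ham_y p 0 g \<in> gen" "ham_x p 0 g \<in> gen"
proof -
  have z: "ham_z p (monom 1 1) \<in> gen" by (rule generators_in_gen) simp
  have "ham_y p 0 (monom 1 k) \<in> gen \<and> ham_x p 0 (monom 1 k) \<in> gen" for k
  proof (induction k)
    case 0
    show ?case using generators_in_gen(1,2)[of 0] by (simp add: monom_0)
  next
    case (Suc k)
    then show ?case
      using lie_gen_bracket[OF z, of "ham_y p 0 (monom 1 k)"] lie_gen_bracket[OF z, of "ham_x p 0 (monom 1 k)"]
        gen_scaleD[of "-1" "ham_x p 0 (monom 1 (Suc k))"] gen_scaleD[of 1 "ham_y p 0 (monom 1 (Suc k))"]
      by (simp add: ham_brackets mult_monom)
  qed
  then have deg: "\<exists>q. q \<noteq> 0 \<and> degree q = n \<and> ham_y p 0 q \<in> gen"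
    "\<exists>q. q \<noteq> 0 \<and> degree q = n \<and> ham_x p 0 q \<in> gen" for n
    by (intro exI[of _ "monom 1 n"]; simp add: degree_monom_eq)+
  show "ham_y p 0 g \<in> gen"
    by (rule ham_in_gen_induct[of "ham_y p 0", OF ham_add(1) ham_smult(1) ham_zero(1) deg(1)])
  show "ham_x p 0 g \<in> gen"
    by (rule ham_in_gen_induct[of "ham_x p 0", OF ham_add(2) ham_smult(2) ham_zero(2) deg(2)])
qed

text \<open>The brackets of weight \<open>0\<close> produce the second derivatives of multiples of \<open>p\<close>, which have
  every degree from \<open>degree p - 2\<close> on; the generators \<open>z\<^sup>m H\<close> supply the lower degrees.\<close>

lemma ham_z_in_gen: "ham_z p g \<in> gen"
proof (intro ham_in_gen_induct ham_add ham_smult ham_zero)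
  fix m
  show "\<exists>q. q \<noteq> 0 \<and> degree q = m \<and> ham_z p q \<in> gen"
  proof (cases "m \<le> max 2 (degree p - 3)")
    case True
    then show ?thesis
      using generators_in_gen(3) by (intro exI[of _ "monom 1 m"]) (simp add: degree_monom_eq)
  next
    case False
    \<comment> \<open>This \<open>k\<close> gives \<open>p * monom 1 k\<close> degree
      \<open>m + 2\<close>, hence its second derivative degree \<open>m\<close>. The subtraction is
      not truncated, since \<open>m\<close> exceeds \<open>degree p - 3\<close>, and
      \<open>m > 2\<close> makes \<open>q\<close> nonzero.\<close>
    define k where "k = m + 2 - degree p"
    define q where "q = pderiv (pderiv (p * monom 1 k))"
    have "degree p \<le> m + 2" using False by auto
    then have "degree (p * monom 1 k) = m + 2"
      using p_nonzero by (simp add: degree_mult_eq degree_monom_eq k_def)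
    then have "degree q = m" by (simp add: q_def degree_pderiv)
    moreover from this have "q \<noteq> 0" using False by auto
    moreover have "ham_z p q \<in> gen"
      using lie_gen_bracket[OF ham_0_in_gen(2)[of "monom 1 k"] ham_0_in_gen(1)[of 1]]
      by (intro gen_scaleD[of "-1" "ham_z p q"]) (simp_all add: ham_brackets q_def)
    ultimately show ?thesis by blast
  qed
qed

text \<open>Brackets with the fields of \<open>y z\<close> and \<open>x z\<close> raise the exponent
  by one at coefficient 1. A final bracket with \<open>ham_z p g\<close> turns the coefficient into
  \<open>g\<close>.\<close>

lemma ham_in_gen: "ham_y p n g \<in> gen" "ham_x p n g \<in> gen"
proof -
  have "ham_y p n 1 \<in> gen \<and> ham_x p n 1 \<in> gen"
  proof (induction n)
    case 0
    show ?case by (simp add: ham_0_in_gen)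
  next
    case (Suc n)
    have c: "- of_nat (Suc n) \<noteq> (0 :: complex)" by (simp del: of_nat_Suc)
    have "vf_scale (- of_nat (Suc n)) (ham_y p (Suc n) 1) \<in> gen"
      "vf_scale (- of_nat (Suc n)) (ham_x p (Suc n) 1) \<in> gen"
      unfolding ham_brackets(4,5)[symmetric] using Suc by (simp_all add: lie_gen_bracket ham_0_in_gen)
    from this[THEN gen_scaleD, OF c] show ?case by simp
  qed
  then have "lie_bracket (ham_z p g) (ham_y p n 1) \<in> gen" "lie_bracket (ham_z p g) (ham_x p n 1) \<in> gen"
    by (simp_all add: lie_gen_bracket ham_z_in_gen)
  from this[unfolded ham_brackets mult_1_right, THEN gen_scaleD]
  show "ham_y p n g \<in> gen" "ham_x p n g \<in> gen" by (simp_all del: of_nat_Suc)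
qed

section \<open>The two inclusions between generated and volume-preserving fields\<close>

lemma vp_generators_cases:
  assumes "D \<in> vp_generators p"
  obtains n where "D = ham_y p n [:1 / of_nat (Suc n):]"
  | n where "D = ham_x p n [:1 / of_nat (Suc n):]"
  | m where "D = ham_z p (monom 1 m)"
proof -
  from assms consider n where "D = vf_mult (\<lambda>(x, y, z). y ^ n) (field_V p)"
    | n where "D = vf_mult (\<lambda>(x, y, z). x ^ n) (field_W p)"
    | m where "D = vf_mult (\<lambda>(x, y, z). z ^ m) (field_H p)"
    unfolding vp_generators_def by auto
  then show ?thesis
    by cases (simp_all only: ham_generators[symmetric] that)
qed

lemma gen_subset_vp: "gen \<subseteq> vp_alg_vfields p"
proof
  fix D assume "D \<in> gen"
  then show "D \<in> vp_alg_vfields p"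
  proof induction
    case (lie_gen_base A)
    then show ?case by (cases rule: vp_generators_cases) (simp_all add: ham_vp)
  qed (simp_all add: vp_zero vp_add vp_scale vp_bracket)
qed

text \<open>As values on \<open>z\<close>, the fields \<open>ham_y\<close> and \<open>ham_x\<close>
  realise every monomial with a positive power of \<open>y\<close> or of \<open>x\<close> alone.
  Modulo these a regular function is a polynomial in \<open>z\<close>.\<close>

lemma coord_ring_mod_gen:
  assumes "f \<in> coord_ring p"
  obtains D r where "D \<in> gen" "f = (\<lambda>q. D (coord_z p) q + surface_monom p 0 0 r q)"
proof -
  from assms obtain F where F: "F \<in> polyfun" "f = on_surface p F" by (rule coord_ring_cases)
  define Q where "Q u \<longleftrightarrow> (\<exists>D\<in>gen. \<exists>r. u = (\<lambda>q. D (coord_z p) q + surface_monom p 0 0 r q))"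
    for u :: "point \<Rightarrow> complex"
  have add: "Q (\<lambda>q. u q + v q)" if uv: "Q u" "Q v" for u v
  proof -
    from uv obtain D E r s where DE: "D \<in> gen" "E \<in> gen"
      "u = (\<lambda>q. D (coord_z p) q + surface_monom p 0 0 r q)"
      "v = (\<lambda>q. E (coord_z p) q + surface_monom p 0 0 s q)" by (auto simp: Q_def)
    have "surface_monom p 0 0 (r + s) q = surface_monom p 0 0 r q + surface_monom p 0 0 s q" for q
      by (cases q) (auto simp: surface_monom_def monom_fun_def on_surface_def)
    then have "(\<lambda>q. u q + v q) = (\<lambda>q. vf_add D E (coord_z p) q + surface_monom p 0 0 (r + s) q)"
      by (simp add: DE vf_add_def algebra_simps)
    then show ?thesis using lie_gen_add[OF DE(1,2)] unfolding Q_def by blast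
  qed
  have z0: "surface_monom p 0 0 0 = (\<lambda>_. 0)"
    by (auto simp: surface_monom_def monom_fun_def on_surface_def)
  \<comment> \<open>A mixed monomial loses one power each of \<open>x\<close> and \<open>y\<close>
    and gains a factor \<open>p\<close>, so \<open>j\<close> and \<open>g\<close> must vary in the
    induction.\<close>
  have monom: "Q (surface_monom p i j g)" for i j g
  proof (induction i arbitrary: j g)
    case 0
    show ?case
    proof (cases j)
      case 0
      then show ?thesis
        unfolding Q_def by (intro bexI[OF _ lie_gen_zero] exI[of _ g]) (simp add: vf_zero_def)
    next
      case (Suc n)
      then show ?thesis
        unfolding Q_def
        by (intro bexI[of _ "ham_y p n (smult (1 / of_nat (Suc n)) g)"] exI[of _ 0])
          (simp_all add: ham_y_coords ham_in_gen z0 del: of_nat_Suc)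
    qed
  next
    case (Suc i)
    show ?case
    proof (cases j)
      case 0
      then show ?thesis
        unfolding Q_def
        by (intro bexI[of _ "ham_x p i (smult (1 / of_nat (Suc i)) g)"] exI[of _ 0])
          (simp_all add: ham_x_coords ham_in_gen z0 del: of_nat_Suc)
    qed (simp add: surface_monom_Suc_Suc Suc)
  qed
  have "Q (on_surface p F)"
  proof (rule polyfun_monomial_induct[OF F(1), of "\<lambda>F. Q (on_surface p F)"])
    show "Q (on_surface p (\<lambda>q. u q + v q))" if "Q (on_surface p u)" "Q (on_surface p v)" for u v
    proof -
      have "on_surface p (\<lambda>q. u q + v q) = (\<lambda>q. on_surface p u q + on_surface p v q)"
        by (auto simp: on_surface_def)
      with add[OF that] show ?thesis by simp
    qed
    show "Q (on_surface p (monom_fun i j g))" for i j g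
      using monom[of i j g] by (simp add: surface_monom_def)
  qed
  with that show ?thesis unfolding F(2) Q_def by blast
qed

text \<open>Along the orbits of \<open>H\<close>, which are \<open>2\<pi>i\<close>-periodic, \<open>e\<^sup>t \<Theta>(x)\<close> grows linearly with
  slope \<open>x r'(z)\<close>; hence \<open>r\<close> is constant, and it vanishes at the fixed points of \<open>H\<close>.\<close>

lemma vp_vertical_eq_ham_z:
  assumes vp: "\<Theta> \<in> vp_alg_vfields p" and z: "\<Theta> (coord_z p) = surface_monom p 0 0 r"
  obtains g where "\<Theta> = ham_z p g"
proof -
  have T: "\<Theta> \<in> alg_vfields p" using vp by (simp add: vp_alg_vfields_def)
  from alg_vfield_closed[OF T coord_ring_coords(1)]
  obtain F where F: "F \<in> polyfun" "\<Theta> (coord_x p) = on_surface p F" by (rule coord_ring_cases)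
  have div: "field_H p (on_surface p F) (x, y, z) = x * poly (pderiv r) z - F (x, y, z)"
    if q: "(x, y, z) \<in> Danielewski p" for x y z
  proof -
    have "\<Theta> (coord_x p) (x, y, z) =
        field_W p (\<Theta> (coord_z p)) (x, y, z) - field_H p (\<Theta> (coord_x p)) (x, y, z)"
      using vp by (auto simp: vp_alg_vfields_def volume_preserving_iff dest: fun_cong[of _ _ "(x, y, z)"])
    moreover have "field_W p (\<Theta> (coord_z p)) (x, y, z) = x * poly (pderiv r) z"
      using q by (simp add: z alg_vfield_surface_monom[OF field_W_alg q] field_W_coords)
    ultimately show ?thesis using q by (simp add: F(2) on_surface_def[of p F])
  qed
  have flow: "exp t * F (x * exp (- t), y * exp t, z) = F (x, y, z) + x * poly (pderiv r) z * t"
    if q: "(x, y, z) \<in> Danielewski p" for x y z t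
  proof -
    \<comment> \<open>The factor \<open>exp t\<close> cancels the term \<open>- F\<close> in
      \<open>div\<close>, and the linear term cancels the rest, so \<open>G\<close> has derivative
      0.\<close>
    define G where "G t = exp t * F (x * exp (- t), y * exp t, z) - x * poly (pderiv r) z * t" for t
    have qt: "(x * exp (- t), y * exp t, z) \<in> Danielewski p" for t
      using q by (simp add: Danielewski_def exp_minus field_simps)
    have dF: "((\<lambda>s. F (x * exp (- s), y * exp s, z)) has_field_derivative
        x * exp (- t) * poly (pderiv r) z - F (x * exp (- t), y * exp t, z)) (at t)" for t
      unfolding div[OF qt, symmetric] using qt
      by (intro alg_vfield_along[OF field_H_alg F(1)])
        (auto simp: field_H_coords intro!: derivative_eq_intros)
    have "(G has_field_derivative 0) (at t)" for t
      unfolding G_def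
      by (rule derivative_eq_intros dF refl)+ (simp add: exp_minus field_simps)
    then have "\<exists>c. \<forall>t\<in>UNIV. G t = c"
      by (intro has_field_derivative_zero_constant) auto
    then have "G t = G 0" by auto
    then show ?thesis by (simp add: G_def algebra_simps)
  qed
  \<comment> \<open>After time \<open>2 * pi * \<i>\<close> the orbit of \<open>(1, p(z), z)\<close>
    has returned to its start, which leaves only the linear term.\<close>
  have "poly (pderiv r) z = 0" for z
    using flow[of 1 "poly p z" z "2 * of_real pi * \<i>"] by (simp add: Danielewski_def exp_minus)
  then have r': "pderiv r = 0" using poly_all_0_iff_0 by blast
  then obtain c where c: "r = [:c:]" by (metis pderiv_eq_0_iff degree_eq_zeroE)
  \<comment> \<open>At \<open>x = y = 0\<close> tangency reads \<open>p'(z) c = 0\<close>, and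
    \<open>p'(z)\<close> is nonzero at a zero of \<open>p\<close>.\<close>
  have "c = 0"
  proof -
    from nonconstant obtain z where "poly p z = 0"
      using fundamental_theorem_of_algebra[of p] constant_degree[of p] by auto
    then show ?thesis
      using alg_vfield_tangent[OF T, of 0 0 z] pderiv_at_root[of z] by (simp add: Danielewski_def z c)
  qed
  obtain g where g: "poly g z = F (1, poly p z, z)" for z
    using polyfun_on_section[OF F(1)] by blast
  \<comment> \<open>The sign of the coefficient reflects \<open>H(x) = - x\<close>.\<close>
  have "\<Theta> = ham_z p (- g)"
  proof (rule alg_vfield_eqI[OF T ham_alg(3)])
    show "\<Theta> (coord_z p) = ham_z p (- g) (coord_z p)" by (simp add: z ham_z_coords c \<open>c = 0\<close>)
    show "\<Theta> (coord_x p) = ham_z p (- g) (coord_x p)"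
    proof (rule coord_ring_eqI)
      fix x y z assume q: "(x, y, z) \<in> Danielewski p" "x \<noteq> 0"
      \<comment> \<open>Time \<open>ln x\<close> moves the point along its \<open>H\<close>-orbit to
        the section \<open>x = 1\<close>.\<close>
      have "F (x, y, z) = x * F (1, y * x, z)"
        using flow[OF q(1), of "ln x"] q(2) by (simp add: r' exp_minus)
      then show "\<Theta> (coord_x p) (x, y, z) = ham_z p (- g) (coord_x p) (x, y, z)"
        using q Danielewski_eq[OF q(1)] by (simp add: F(2) ham_z_coords g on_surface_def mult.commute)
    qed (simp_all add: alg_vfield_closed[OF T] ham_z_coords)
  qed
  with that show ?thesis by blast
qed

text \<open>Subtracting a generated field makes the value on \<open>z\<close> a polynomial in
  \<open>z\<close>. The difference is still volume-preserving by the other inclusion, hence some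
  \<open>ham_z p g\<close>, which is generated as well.\<close>

lemma vp_subset_gen: "vp_alg_vfields p \<subseteq> gen"
proof
  fix \<Theta> assume vp: "\<Theta> \<in> vp_alg_vfields p"
  then have T: "\<Theta> \<in> alg_vfields p" by (simp add: vp_alg_vfields_def)
  from alg_vfield_closed[OF T coord_ring_coords(3)] obtain D r where D: "D \<in> gen"
    "\<Theta> (coord_z p) = (\<lambda>q. D (coord_z p) q + surface_monom p 0 0 r q)" by (rule coord_ring_mod_gen)
  have "vf_add \<Theta> (vf_scale (-1) D) \<in> vp_alg_vfields p"
    using D(1) gen_subset_vp vp by (blast intro: vp_add vp_scale)
  moreover have "vf_add \<Theta> (vf_scale (-1) D) (coord_z p) = surface_monom p 0 0 r"
    by (simp add: vf_add_def vf_scale_def vf_mult_def D(2))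
  ultimately obtain g where "vf_add \<Theta> (vf_scale (-1) D) = ham_z p g" by (rule vp_vertical_eq_ham_z)
  then have "vf_add (vf_add \<Theta> (vf_scale (-1) D)) D \<in> gen"
    using lie_gen_add[OF ham_z_in_gen D(1)] by simp
  then show "\<Theta> \<in> gen" by (simp add: vf_add_def vf_scale_def vf_mult_def)
qed

end

section \<open>Completeness\<close>

text \<open>It suffices to solve the equations for the three coordinates:
  \<open>alg_vfield_along\<close> passes to all regular functions, and choice assembles the orbits
  into one map.\<close>

lemma complete_vfieldI:
  assumes D: "D \<in> alg_vfields p"
    and flow: "\<And>x y z. (x, y, z) \<in> Danielewski p \<Longrightarrow> \<exists>X Y Z. (X 0, Y 0, Z 0) = (x, y, z) \<and>
      (\<forall>t. (X t, Y t, Z t) \<in> Danielewski p \<and>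
        (X has_field_derivative D (coord_x p) (X t, Y t, Z t)) (at t) \<and>
        (Y has_field_derivative D (coord_y p) (X t, Y t, Z t)) (at t) \<and>
        (Z has_field_derivative D (coord_z p) (X t, Y t, Z t)) (at t))"
  shows "complete_vfield p D"
proof -
  have "\<forall>q. \<exists>\<gamma>. q \<in> Danielewski p \<longrightarrow> \<gamma> 0 = q \<and> (\<forall>t. \<gamma> t \<in> Danielewski p) \<and>
      (\<forall>f \<in> coord_ring p. \<forall>t. ((\<lambda>s. f (\<gamma> s)) has_field_derivative D f (\<gamma> t)) (at t))"
  proof
    fix q :: point
    obtain x y z where q: "q = (x, y, z)" by (cases q)
    show "\<exists>\<gamma>. q \<in> Danielewski p \<longrightarrow> \<gamma> 0 = q \<and> (\<forall>t. \<gamma> t \<in> Danielewski p) \<and>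
      (\<forall>f \<in> coord_ring p. \<forall>t. ((\<lambda>s. f (\<gamma> s)) has_field_derivative D f (\<gamma> t)) (at t))"
    proof (cases "q \<in> Danielewski p")
      case True
      then obtain X Y Z where c: "(X 0, Y 0, Z 0) = q" "\<And>t. (X t, Y t, Z t) \<in> Danielewski p"
        "\<And>t. (X has_field_derivative D (coord_x p) (X t, Y t, Z t)) (at t)"
        "\<And>t. (Y has_field_derivative D (coord_y p) (X t, Y t, Z t)) (at t)"
        "\<And>t. (Z has_field_derivative D (coord_z p) (X t, Y t, Z t)) (at t)"
        using flow[of x y z] unfolding q by blast
      have "((\<lambda>s. f (X s, Y s, Z s)) has_field_derivative D f (X t, Y t, Z t)) (at t)"
        if f: "f \<in> coord_ring p" for f t
      proof -
        from f obtain F where F: "F \<in> polyfun" "f = on_surface p F" by (rule coord_ring_cases)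
        have "(\<lambda>s. f (X s, Y s, Z s)) = (\<lambda>s. F (X s, Y s, Z s))"
          using c(2) by (simp add: F(2) on_surface_def)
        then show ?thesis using alg_vfield_along[OF D F(1) c(2-5)] by (simp add: F(2))
      qed
      with c show ?thesis by (intro exI[of _ "\<lambda>t. (X t, Y t, Z t)"]) simp
    qed simp
  qed
  from choice[OF this] obtain \<gamma> where "\<forall>q. q \<in> Danielewski p \<longrightarrow> \<gamma> q 0 = q \<and> (\<forall>t. \<gamma> q t \<in> Danielewski p) \<and>
      (\<forall>f \<in> coord_ring p. \<forall>t. ((\<lambda>s. f (\<gamma> q s)) has_field_derivative D f (\<gamma> q t)) (at t))" ..
  then show ?thesis
    unfolding complete_vfield_def by (intro exI[of _ "\<lambda>t q. \<gamma> q t"]) blast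
qed

text \<open>Along an orbit \<open>y\<close> is constant, so \<open>z\<close> moves linearly in
  time.\<close>

lemma complete_ham_y: "complete_vfield p (ham_y p n [:1 / of_nat (Suc n):])"
proof (rule complete_vfieldI[OF ham_alg(1)])
  fix x y z assume q: "(x, y, z) \<in> Danielewski p"
  let ?D = "ham_y p n [:1 / of_nat (Suc n):]"
  have D: "?D (coord_x p) (a, b, c) = b ^ n * poly (pderiv p) c" "?D (coord_y p) (a, b, c) = 0"
    "?D (coord_z p) (a, b, c) = b ^ Suc n" if "(a, b, c) \<in> Danielewski p" for a b c
    using that by (simp_all add: ham_y_coords del: of_nat_Suc)
  let ?Z = "\<lambda>t. z + t * y ^ Suc n"
  \<comment> \<open>For \<open>y\<close> nonzero the surface equation determines \<open>x\<close>.
    For \<open>y = 0\<close> also \<open>z\<close> is fixed and \<open>x\<close> moves linearly,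
    with nonzero speed only when \<open>n = 0\<close>.\<close>
  let ?X = "\<lambda>t. if y = 0 then x + t * (y ^ n * poly (pderiv p) z) else poly p (?Z t) / y"
  have S: "(?X t, y, ?Z t) \<in> Danielewski p" for t
    using q by (auto simp: Danielewski_def)
  have d: "(?X has_field_derivative y ^ n * poly (pderiv p) (?Z t)) (at t)" for t
    by (cases "y = 0") (auto intro!: derivative_eq_intros)
  show "\<exists>X Y Z. (X 0, Y 0, Z 0) = (x, y, z) \<and> (\<forall>t. (X t, Y t, Z t) \<in> Danielewski p \<and>
      (X has_field_derivative ?D (coord_x p) (X t, Y t, Z t)) (at t) \<and>
      (Y has_field_derivative ?D (coord_y p) (X t, Y t, Z t)) (at t) \<and>
      (Z has_field_derivative ?D (coord_z p) (X t, Y t, Z t)) (at t))"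
    by (rule exI[of _ ?X], rule exI[of _ "\<lambda>_. y"], rule exI[of _ ?Z], intro conjI allI S; (unfold D[OF S])?)
      (use d Danielewski_eq[OF q] in \<open>auto intro!: derivative_eq_intros\<close>)
qed

lemma complete_ham_x: "complete_vfield p (ham_x p n [:1 / of_nat (Suc n):])"
proof (rule complete_vfieldI[OF ham_alg(2)])
  fix x y z assume q: "(x, y, z) \<in> Danielewski p"
  let ?D = "ham_x p n [:1 / of_nat (Suc n):]"
  have D: "?D (coord_x p) (a, b, c) = 0" "?D (coord_y p) (a, b, c) = a ^ n * poly (pderiv p) c"
    "?D (coord_z p) (a, b, c) = a ^ Suc n" if "(a, b, c) \<in> Danielewski p" for a b c
    using that by (simp_all add: ham_x_coords del: of_nat_Suc)
  let ?Z = "\<lambda>t. z + t * x ^ Suc n"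
  let ?Y = "\<lambda>t. if x = 0 then y + t * (x ^ n * poly (pderiv p) z) else poly p (?Z t) / x"
  have S: "(x, ?Y t, ?Z t) \<in> Danielewski p" for t
    using q by (auto simp: Danielewski_def)
  have d: "(?Y has_field_derivative x ^ n * poly (pderiv p) (?Z t)) (at t)" for t
    by (cases "x = 0") (auto intro!: derivative_eq_intros)
  show "\<exists>X Y Z. (X 0, Y 0, Z 0) = (x, y, z) \<and> (\<forall>t. (X t, Y t, Z t) \<in> Danielewski p \<and>
      (X has_field_derivative ?D (coord_x p) (X t, Y t, Z t)) (at t) \<and>
      (Y has_field_derivative ?D (coord_y p) (X t, Y t, Z t)) (at t) \<and>
      (Z has_field_derivative ?D (coord_z p) (X t, Y t, Z t)) (at t))"
    by (rule exI[of _ "\<lambda>_. x"], rule exI[of _ ?Y], rule exI[of _ ?Z], intro conjI allI S; (unfold D[OF S])?)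
      (use d Danielewski_eq[OF q] in \<open>auto intro!: derivative_eq_intros\<close>)
qed

text \<open>The coefficient depends on \<open>z\<close> alone and \<open>H\<close> fixes
  \<open>z\<close>, so each orbit of \<open>H\<close> is only rescaled in time.\<close>

lemma complete_ham_z: "complete_vfield p (ham_z p g)"
proof (rule complete_vfieldI[OF ham_alg(3)])
  fix x y z assume q: "(x, y, z) \<in> Danielewski p"
  let ?D = "ham_z p g"
  have D: "?D (coord_x p) (a, b, c) = - poly g c * a" "?D (coord_y p) (a, b, c) = poly g c * b"
    "?D (coord_z p) (a, b, c) = 0" if "(a, b, c) \<in> Danielewski p" for a b c
    using that by (simp_all add: ham_z_coords)
  let ?X = "\<lambda>t. x * exp (- (poly g z * t))" and ?Y = "\<lambda>t. y * exp (poly g z * t)"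
  have S: "(?X t, ?Y t, z) \<in> Danielewski p" for t
    using q by (simp add: Danielewski_def exp_minus field_simps)
  show "\<exists>X Y Z. (X 0, Y 0, Z 0) = (x, y, z) \<and> (\<forall>t. (X t, Y t, Z t) \<in> Danielewski p \<and>
      (X has_field_derivative ?D (coord_x p) (X t, Y t, Z t)) (at t) \<and>
      (Y has_field_derivative ?D (coord_y p) (X t, Y t, Z t)) (at t) \<and>
      (Z has_field_derivative ?D (coord_z p) (X t, Y t, Z t)) (at t))"
    by (rule exI[of _ ?X], rule exI[of _ ?Y], rule exI[of _ "\<lambda>_. z"], intro conjI allI S; (unfold D[OF S])?)
      (auto intro!: derivative_eq_intros)
qed

theorem theorem5p1:
  fixes p :: "complex poly"
  assumes nonconstant: "degree p > 0"
    and simple_zeros: "\<forall>z. poly p z = 0 \<longrightarrow> order z p = 1"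
  shows "(\<forall>\<Theta> \<in> vp_generators p.
            \<Theta> \<in> alg_vfields p \<and> complete_vfield p \<Theta> \<and> volume_preserving p \<Theta>) \<and>
         lie_algebra_generated (vp_generators p) = vp_alg_vfields p"
proof -
  interpret smooth_danielewski p
    using assms by unfold_locales
  have "\<Theta> \<in> vp_alg_vfields p \<and> complete_vfield p \<Theta>" if "\<Theta> \<in> vp_generators p" for \<Theta>
    using that by (cases rule: vp_generators_cases)
      (simp_all add: ham_vp complete_ham_y complete_ham_x complete_ham_z del: of_nat_Suc)
  then show ?thesis
    using gen_subset_vp vp_subset_gen by (auto simp: vp_alg_vfields_def)
qed

end
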